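(* The product $\mathsf{Pow}(\{\top\})_{\neg\neg}\times\mathsf{Pow}(\{\top\})_{\neg\neg}$ in the category FSp of formal spaces exists and is $\mathsf{Pow}(\{\top\})_{\neg\neg}$ itself. Consequently the product of $S_{DM}$ with itself in FSp is predicatively definable.
   Context: One works in Aczel's constructive set theory CZF or in Martin-Löf type theory CTT (with no impredicative principles assumed; "predicatively definable" means definable in these settings). A formal topology (formal space) is a pair $(S,\vartriangleleft)$ with $S$ a set and $\vartriangleleft$ a relation between elements and subsets of $S$ such that: $a\in U$ implies $a\vartriangleleft U$; $a\vartriangleleft U$ and $U\vartriangleleft V$ imply $a\vartriangleleft V$; $a\vartriangleleft U$ and $a\vartriangleleft V$ imply $a\vartriangleleft U\downarrow V$; and (in CZF) $\{a\in S:a\vartriangleleft U\}$ is a set for every $U\subseteq S$. Here $U\vartriangleleft V$ means $(\forall u\in U)\,u\vartriangleleft V$, and $U\downarrow V\equiv\{d\in S:(\exists u\in U)\,d\vartriangleleft\{u\}\ \&\ (\exists v\in V)\,d\vartriangleleft\{v\}\}$. $U=_SV$ means $U\vartriangleleft V$ and $V\vartriangleleft U$. A morphism $f:S_1\to S_2$ of formal topologies is a map $f:S_1\to\mathsf{Pow}(S_2)$ (subsets of $S_2$) such that $f(S_1)=_{S_2}S_2$; $f(a)\downarrow f(b)\vartriangleleft f(a\downarrow b)$; and $a\vartriangleleft U$ implies $f(a)\vartriangleleft f(U)$, where $f(U)\equiv\bigcup_{a\in U}f(a)$. Two morphisms $f,g$ are equal if $f(a)=_{S_2}g(a)$ for all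 $a\in S_1$; the identity is $a\mapsto\{a\}$. FSp is the opposite of the category of formal topologies and these morphisms. $\mathsf{Pow}(\{\top\})_{\neg\neg}$ is the formal space on the one-element set $\{\top\}$ with covering $\top\vartriangleleft U\iff\neg\neg(\top\in U)$. $S_{DM}$ is the formal space on $\{0,1\}$ with its natural order $0\leq1$ and covering $a\vartriangleleft_{DM}U\iff(\forall y)\bigl([(\forall u\in U)\,u\leq y]\to a\leq y\bigr)$. *)

theory Defs
  imports Main
begin

text \<open>
  HOL is classical and impredicative, so a direct rendering of the double negation covering in HOL
  would collapse it.  Instead, the mathematics takes place inside the theory CZF: its first-order
  language, intuitionistic deduction and the axioms are formalised, formal topologies and
  morphisms are formulas of this language, and all claims are claims of derivability in CZF.
\<close>

section \<open>Intuitionistic first-order logic with membership and equality\<close>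

text \<open>De Bruijn indices; the only terms are variables.\<close>

datatype fm =
    Mem nat nat
  | Eq nat nat
  | Bot
  | Conj fm fm
  | Disj fm fm
  | Imp fm fm
  | Forall fm
  | Exists fm

fun lift :: "(nat \<Rightarrow> nat) \<Rightarrow> nat \<Rightarrow> nat" where
  "lift r 0 = 0"
| "lift r (Suc i) = Suc (r i)"

text \<open>Capture-avoiding simultaneous replacement of variables by variables.\<close>

primrec ren :: "(nat \<Rightarrow> nat) \<Rightarrow> fm \<Rightarrow> fm" where
  "ren r (Mem i j) = Mem (r i) (r j)"
| "ren r (Eq i j) = Eq (r i) (r j)"
| "ren r Bot = Bot"
| "ren r (Conj p q) = Conj (ren r p) (ren r q)"
| "ren r (Disj p q) = Disj (ren r p) (ren r q)"
| "ren r (Imp p q) = Imp (ren r p) (ren r q)"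
| "ren r (Forall p) = Forall (ren (lift r) p)"
| "ren r (Exists p) = Exists (ren (lift r) p)"

definition inst :: "fm \<Rightarrow> nat \<Rightarrow> fm" where
  "inst p t = ren (\<lambda>i. case i of 0 \<Rightarrow> t | Suc j \<Rightarrow> j) p"

primrec fv :: "fm \<Rightarrow> nat set" where
  "fv (Mem i j) = {i, j}"
| "fv (Eq i j) = {i, j}"
| "fv Bot = {}"
| "fv (Conj p q) = fv p \<union> fv q"
| "fv (Disj p q) = fv p \<union> fv q"
| "fv (Imp p q) = fv p \<union> fv q"
| "fv (Forall p) = {i. Suc i \<in> fv p}"
| "fv (Exists p) = {i. Suc i \<in> fv p}"

text \<open>
  Natural deduction.  The set of axioms is not shifted in the eigenvariable rules, i.e. free
  variables of axioms are read as universally quantified.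
\<close>

inductive derives :: "fm set \<Rightarrow> fm list \<Rightarrow> fm \<Rightarrow> bool" for Ax :: "fm set" where
  hyp: "p \<in> set G \<Longrightarrow> derives Ax G p"
| ax: "p \<in> Ax \<Longrightarrow> derives Ax G p"
| BotE: "derives Ax G Bot \<Longrightarrow> derives Ax G p"
| ConjI: "derives Ax G p \<Longrightarrow> derives Ax G q \<Longrightarrow> derives Ax G (Conj p q)"
| ConjE1: "derives Ax G (Conj p q) \<Longrightarrow> derives Ax G p"
| ConjE2: "derives Ax G (Conj p q) \<Longrightarrow> derives Ax G q"
| DisjI1: "derives Ax G p \<Longrightarrow> derives Ax G (Disj p q)"
| DisjI2: "derives Ax G q \<Longrightarrow> derives Ax G (Disj p q)"
| DisjE: "derives Ax G (Disj p q) \<Longrightarrow> derives Ax (p # G) s \<Longrightarrow> derives Ax (q # G) s \<Longrightarrow> derives Ax G s"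
| ImpI: "derives Ax (p # G) q \<Longrightarrow> derives Ax G (Imp p q)"
| ImpE: "derives Ax G (Imp p q) \<Longrightarrow> derives Ax G p \<Longrightarrow> derives Ax G q"
| ForallI: "derives Ax (map (ren Suc) G) p \<Longrightarrow> derives Ax G (Forall p)"
| ForallE: "derives Ax G (Forall p) \<Longrightarrow> derives Ax G (inst p t)"
| ExistsI: "derives Ax G (inst p t) \<Longrightarrow> derives Ax G (Exists p)"
| ExistsE: "derives Ax G (Exists p) \<Longrightarrow> derives Ax (p # map (ren Suc) G) (ren Suc q) \<Longrightarrow> derives Ax G q"
| EqI: "derives Ax G (Eq i i)"
| EqE: "derives Ax G (Eq i j) \<Longrightarrow> derives Ax G (inst p i) \<Longrightarrow> derives Ax G (inst p j)"

section \<open>Notation with named bound variables\<close>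

text \<open>
  A \<open>form\<close> yields a formula when told the number \<open>d\<close> of binders above it.  A bound variable is
  represented by the level of its binder, counted from the outside; at depth \<open>d\<close> the variable of
  level \<open>x < d\<close> has index \<open>d - 1 - x\<close>, and the indices from \<open>d\<close> on are the free variables
  (parameters).
\<close>

type_synonym var = nat
type_synonym form = "nat \<Rightarrow> fm"
type_synonym cls = "var \<Rightarrow> form"

definition fmem :: "var \<Rightarrow> var \<Rightarrow> form" (infix "\<^bold>\<in>" 60) where
  "(x \<^bold>\<in> y) = (\<lambda>d. Mem (d - 1 - x) (d - 1 - y))"

definition feq :: "var \<Rightarrow> var \<Rightarrow> form" (infix "\<^bold>=" 60) where
  "(x \<^bold>= y) = (\<lambda>d. Eq (d - 1 - x) (d - 1 - y))"

definition fbot :: form ("\<^bold>\<bottom>") where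
  "\<^bold>\<bottom> = (\<lambda>d. Bot)"

definition fconj :: "form \<Rightarrow> form \<Rightarrow> form" (infixr "\<^bold>\<and>" 45) where
  "(P \<^bold>\<and> Q) = (\<lambda>d. Conj (P d) (Q d))"

definition fdisj :: "form \<Rightarrow> form \<Rightarrow> form" (infixr "\<^bold>\<or>" 40) where
  "(P \<^bold>\<or> Q) = (\<lambda>d. Disj (P d) (Q d))"

definition fimp :: "form \<Rightarrow> form \<Rightarrow> form" (infixr "\<^bold>\<longrightarrow>" 35) where
  "(P \<^bold>\<longrightarrow> Q) = (\<lambda>d. Imp (P d) (Q d))"

definition fall :: "(var \<Rightarrow> form) \<Rightarrow> form" (binder "\<^bold>\<forall>" 10) where
  "fall P = (\<lambda>d. Forall (P d (Suc d)))"

definition fex :: "(var \<Rightarrow> form) \<Rightarrow> form" (binder "\<^bold>\<exists>" 10) where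
  "fex P = (\<lambda>d. Exists (P d (Suc d)))"

definition fnot :: "form \<Rightarrow> form" ("\<^bold>\<not> _" [50] 50) where
  "(\<^bold>\<not> P) = (P \<^bold>\<longrightarrow> \<^bold>\<bottom>)"

definition fiff :: "form \<Rightarrow> form \<Rightarrow> form" (infixr "\<^bold>\<longleftrightarrow>" 30) where
  "(P \<^bold>\<longleftrightarrow> Q) = ((P \<^bold>\<longrightarrow> Q) \<^bold>\<and> (Q \<^bold>\<longrightarrow> P))"

definition fex1 :: "(var \<Rightarrow> form) \<Rightarrow> form" (binder "\<^bold>\<exists>\<^bold>!" 10) where
  "fex1 P = (\<^bold>\<exists>x. P x \<^bold>\<and> (\<^bold>\<forall>y. P y \<^bold>\<longrightarrow> y \<^bold>= x))"

text \<open>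
  \<open>sch p xs\<close> is the formula \<open>p\<close> with its first variables replaced by the bound variables \<open>xs\<close>;
  the remaining free variables of \<open>p\<close> are parameters.
\<close>

definition sch :: "fm \<Rightarrow> var list \<Rightarrow> form" where
  "sch p xs = (\<lambda>d. ren (\<lambda>i. if i < length xs then d - 1 - xs ! i else d + (i - length xs)) p)"

text \<open>The set \<open>z\<close> has the same elements as the class \<open>C\<close>.\<close>

definition is_set_of :: "var \<Rightarrow> cls \<Rightarrow> form" (infix "\<^bold>\<equiv>" 60) where
  "(z \<^bold>\<equiv> C) = (\<^bold>\<forall>x. x \<^bold>\<in> z \<^bold>\<longleftrightarrow> C x)"

definition el :: "var \<Rightarrow> cls" where
  "el u = (\<lambda>x. x \<^bold>\<in> u)"

definition sing :: "var \<Rightarrow> cls" where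
  "sing a = (\<lambda>x. x \<^bold>= a)"

definition upair :: "var \<Rightarrow> var \<Rightarrow> cls" where
  "upair a b = (\<lambda>x. x \<^bold>= a \<^bold>\<or> x \<^bold>= b)"

definition subcls :: "cls \<Rightarrow> cls \<Rightarrow> form" (infix "\<^bold>\<subseteq>" 60) where
  "(C \<^bold>\<subseteq> D) = (\<^bold>\<forall>x. C x \<^bold>\<longrightarrow> D x)"

definition is_zero :: "var \<Rightarrow> form" where
  "is_zero x = (x \<^bold>\<equiv> (\<lambda>y. \<^bold>\<bottom>))"

definition is_one :: "var \<Rightarrow> form" where
  "is_one x = (x \<^bold>\<equiv> is_zero)"

definition is_succ :: "var \<Rightarrow> var \<Rightarrow> form" where
  "is_succ y x = (y \<^bold>\<equiv> (\<lambda>z. z \<^bold>\<in> x \<^bold>\<or> z \<^bold>= x))"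

text \<open>Kuratowski pairs.\<close>

definition is_pair :: "var \<Rightarrow> var \<Rightarrow> var \<Rightarrow> form" where
  "is_pair p a b = (p \<^bold>\<equiv> (\<lambda>z. z \<^bold>\<equiv> sing a \<^bold>\<or> z \<^bold>\<equiv> upair a b))"

section \<open>Aczel's constructive set theory CZF\<close>

inductive bounded :: "fm \<Rightarrow> bool" where
  "bounded (Mem i j)"
| "bounded (Eq i j)"
| "bounded Bot"
| "bounded p \<Longrightarrow> bounded q \<Longrightarrow> bounded (Conj p q)"
| "bounded p \<Longrightarrow> bounded q \<Longrightarrow> bounded (Disj p q)"
| "bounded p \<Longrightarrow> bounded q \<Longrightarrow> bounded (Imp p q)"
| "bounded p \<Longrightarrow> bounded (Forall (Imp (Mem 0 (Suc j)) p))"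
| "bounded p \<Longrightarrow> bounded (Exists (Conj (Mem 0 (Suc j)) p))"

definition ax_extensionality :: form where
  "ax_extensionality = (\<^bold>\<forall>a. \<^bold>\<forall>b. a \<^bold>\<equiv> el b \<^bold>\<longrightarrow> a \<^bold>= b)"

definition ax_pairing :: form where
  "ax_pairing = (\<^bold>\<forall>a. \<^bold>\<forall>b. \<^bold>\<exists>c. c \<^bold>\<equiv> upair a b)"

definition ax_union :: form where
  "ax_union = (\<^bold>\<forall>a. \<^bold>\<exists>b. b \<^bold>\<equiv> (\<lambda>x. \<^bold>\<exists>y. y \<^bold>\<in> a \<^bold>\<and> x \<^bold>\<in> y))"

definition is_inductive :: "var \<Rightarrow> form" where
  "is_inductive a =
    ((\<^bold>\<exists>y. y \<^bold>\<in> a \<^bold>\<and> is_zero y) \<^bold>\<and>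
     (\<^bold>\<forall>y. y \<^bold>\<in> a \<^bold>\<longrightarrow> (\<^bold>\<exists>z. z \<^bold>\<in> a \<^bold>\<and> is_succ z y)))"

definition ax_infinity :: form where
  "ax_infinity = (\<^bold>\<exists>a. is_inductive a \<^bold>\<and> (\<^bold>\<forall>b. is_inductive b \<^bold>\<longrightarrow> el a \<^bold>\<subseteq> el b))"

definition ax_set_induction :: "fm \<Rightarrow> form" where
  "ax_set_induction p =
    ((\<^bold>\<forall>a. (\<^bold>\<forall>x. x \<^bold>\<in> a \<^bold>\<longrightarrow> sch p [x]) \<^bold>\<longrightarrow> sch p [a]) \<^bold>\<longrightarrow> (\<^bold>\<forall>a. sch p [a]))"

definition ax_separation :: "fm \<Rightarrow> form" where
  "ax_separation p = (\<^bold>\<forall>a. \<^bold>\<exists>b. b \<^bold>\<equiv> (\<lambda>x. x \<^bold>\<in> a \<^bold>\<and> sch p [x]))"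

definition ax_strong_collection :: "fm \<Rightarrow> form" where
  "ax_strong_collection p =
    (\<^bold>\<forall>a. (\<^bold>\<forall>x. x \<^bold>\<in> a \<^bold>\<longrightarrow> (\<^bold>\<exists>y. sch p [x, y])) \<^bold>\<longrightarrow>
      (\<^bold>\<exists>b. (\<^bold>\<forall>x. x \<^bold>\<in> a \<^bold>\<longrightarrow> (\<^bold>\<exists>y. y \<^bold>\<in> b \<^bold>\<and> sch p [x, y])) \<^bold>\<and>
           (\<^bold>\<forall>y. y \<^bold>\<in> b \<^bold>\<longrightarrow> (\<^bold>\<exists>x. x \<^bold>\<in> a \<^bold>\<and> sch p [x, y]))))"

definition ax_subset_collection :: "fm \<Rightarrow> form" where
  "ax_subset_collection p =
    (\<^bold>\<forall>a. \<^bold>\<forall>b. \<^bold>\<exists>c. \<^bold>\<forall>u.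
      (\<^bold>\<forall>x. x \<^bold>\<in> a \<^bold>\<longrightarrow> (\<^bold>\<exists>y. y \<^bold>\<in> b \<^bold>\<and> sch p [x, y, u])) \<^bold>\<longrightarrow>
      (\<^bold>\<exists>e. e \<^bold>\<in> c \<^bold>\<and>
        (\<^bold>\<forall>x. x \<^bold>\<in> a \<^bold>\<longrightarrow> (\<^bold>\<exists>y. y \<^bold>\<in> e \<^bold>\<and> sch p [x, y, u])) \<^bold>\<and>
        (\<^bold>\<forall>y. y \<^bold>\<in> e \<^bold>\<longrightarrow> (\<^bold>\<exists>x. x \<^bold>\<in> a \<^bold>\<and> sch p [x, y, u]))))"

definition CZF_axioms :: "fm set" where
  "CZF_axioms =
    {ax_extensionality 0, ax_pairing 0, ax_union 0, ax_infinity 0}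
    \<union> {ax_set_induction p 0 | p. True}
    \<union> {ax_separation p 0 | p. bounded p}
    \<union> {ax_strong_collection p 0 | p. True}
    \<union> {ax_subset_collection p 0 | p. True}"

definition CZF_proves :: "form \<Rightarrow> bool" ("CZF \<turnstile> _" [10] 10) where
  "(CZF \<turnstile> F) \<longleftrightarrow> derives CZF_axioms [] (F 0)"

section \<open>Formal topologies\<close>

text \<open>
  The covering relation \<open>cov T a U\<close>, between elements and subsets of the base, is in general a
  proper class.  The base is given as the class of its elements; it is required to be a set in
  \<open>formal_topology\<close>.
\<close>

record space =
  pts :: cls
  cov :: "var \<Rightarrow> var \<Rightarrow> form"

definition space_of :: "fm \<Rightarrow> fm \<Rightarrow> space" where
  "space_of s c = \<lparr>pts = (\<lambda>a. sch s [a]), cov = (\<lambda>a u. sch c [a, u])\<rparr>"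

text \<open>Coverings are defined for sets only, so covering by a class includes that the class is a set.\<close>

definition ccov :: "space \<Rightarrow> var \<Rightarrow> cls \<Rightarrow> form" where
  "ccov T a C = (\<^bold>\<exists>z. z \<^bold>\<equiv> C \<^bold>\<and> cov T a z)"

definition covers :: "space \<Rightarrow> cls \<Rightarrow> cls \<Rightarrow> form" where
  "covers T C D = (\<^bold>\<forall>c. C c \<^bold>\<longrightarrow> ccov T c D)"

definition cov_eq :: "space \<Rightarrow> cls \<Rightarrow> cls \<Rightarrow> form" where
  "cov_eq T C D = (covers T C D \<^bold>\<and> covers T D C)"

definition down :: "space \<Rightarrow> cls \<Rightarrow> cls \<Rightarrow> cls" where
  "down T C D = (\<lambda>x. pts T x \<^bold>\<and> (\<^bold>\<exists>u. C u \<^bold>\<and> ccov T x (sing u)) \<^bold>\<and> (\<^bold>\<exists>v. D v \<^bold>\<and> ccov T x (sing v)))"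

definition formal_topology :: "space \<Rightarrow> form" where
  "formal_topology T =
    ((\<^bold>\<exists>s. s \<^bold>\<equiv> pts T) \<^bold>\<and>
     (\<^bold>\<forall>a. \<^bold>\<forall>u. pts T a \<^bold>\<and> el u \<^bold>\<subseteq> pts T \<^bold>\<longrightarrow> a \<^bold>\<in> u \<^bold>\<longrightarrow> cov T a u) \<^bold>\<and>
     (\<^bold>\<forall>a. \<^bold>\<forall>u. \<^bold>\<forall>v. pts T a \<^bold>\<and> el u \<^bold>\<subseteq> pts T \<^bold>\<and> el v \<^bold>\<subseteq> pts T \<^bold>\<longrightarrow>
        cov T a u \<^bold>\<and> (\<^bold>\<forall>b. b \<^bold>\<in> u \<^bold>\<longrightarrow> cov T b v) \<^bold>\<longrightarrow> cov T a v) \<^bold>\<and>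
     (\<^bold>\<forall>a. \<^bold>\<forall>u. \<^bold>\<forall>v. pts T a \<^bold>\<and> el u \<^bold>\<subseteq> pts T \<^bold>\<and> el v \<^bold>\<subseteq> pts T \<^bold>\<longrightarrow>
        cov T a u \<^bold>\<and> cov T a v \<^bold>\<longrightarrow> ccov T a (down T (el u) (el v))) \<^bold>\<and>
     (\<^bold>\<forall>u. el u \<^bold>\<subseteq> pts T \<^bold>\<longrightarrow> (\<^bold>\<exists>z. z \<^bold>\<equiv> (\<lambda>a. pts T a \<^bold>\<and> cov T a u))))"

section \<open>Morphisms\<close>

text \<open>Here \<open>f\<close> is a set of pairs; \<open>val_at f a\<close> is the class of elements of its value at \<open>a\<close>.\<close>

definition is_map :: "space \<Rightarrow> space \<Rightarrow> var \<Rightarrow> form" where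
  "is_map A B f =
    ((\<^bold>\<forall>p. p \<^bold>\<in> f \<^bold>\<longrightarrow> (\<^bold>\<exists>a. \<^bold>\<exists>y. pts A a \<^bold>\<and> el y \<^bold>\<subseteq> pts B \<^bold>\<and> is_pair p a y)) \<^bold>\<and>
     (\<^bold>\<forall>a. pts A a \<^bold>\<longrightarrow> (\<^bold>\<exists>\<^bold>!y. \<^bold>\<exists>p. p \<^bold>\<in> f \<^bold>\<and> is_pair p a y)))"

definition val_at :: "var \<Rightarrow> var \<Rightarrow> cls" where
  "val_at f a = (\<lambda>x. \<^bold>\<exists>y. (\<^bold>\<exists>p. p \<^bold>\<in> f \<^bold>\<and> is_pair p a y) \<^bold>\<and> x \<^bold>\<in> y)"

definition im :: "var \<Rightarrow> cls \<Rightarrow> cls" where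
  "im f C = (\<lambda>x. \<^bold>\<exists>a. C a \<^bold>\<and> val_at f a x)"

definition morphism :: "space \<Rightarrow> space \<Rightarrow> var \<Rightarrow> form" where
  "morphism A B f =
    (is_map A B f \<^bold>\<and>
     cov_eq B (im f (pts A)) (pts B) \<^bold>\<and>
     (\<^bold>\<forall>a. \<^bold>\<forall>b. pts A a \<^bold>\<and> pts A b \<^bold>\<longrightarrow>
        covers B (down B (val_at f a) (val_at f b)) (im f (down A (sing a) (sing b)))) \<^bold>\<and>
     (\<^bold>\<forall>a. \<^bold>\<forall>u. pts A a \<^bold>\<and> el u \<^bold>\<subseteq> pts A \<^bold>\<longrightarrow>
        cov A a u \<^bold>\<longrightarrow> covers B (val_at f a) (im f (el u))))"

text \<open>Equality of morphisms, stated for \<open>F\<close> and \<open>G\<close> assigning to each element a class.\<close>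

definition mor_eq :: "space \<Rightarrow> space \<Rightarrow> (var \<Rightarrow> cls) \<Rightarrow> (var \<Rightarrow> cls) \<Rightarrow> form" where
  "mor_eq A B F G = (\<^bold>\<forall>a. pts A a \<^bold>\<longrightarrow> cov_eq B (F a) (G a))"

definition mor_comp :: "var \<Rightarrow> var \<Rightarrow> var \<Rightarrow> cls" where
  "mor_comp h p = (\<lambda>a. im h (val_at p a))"

section \<open>Binary products in FSp\<close>

text \<open>
  FSp is the opposite category, so the projections are morphisms of formal topologies from the
  factors to \<open>P\<close>.  The test objects \<open>T\<close> range over all pairs of classes defined by formulas with
  parameters, hence over a scheme; the projections must therefore be given by defining formulas
  \<open>p\<close> and \<open>q\<close> (without parameters).
\<close>

definition definable :: "nat \<Rightarrow> fm \<Rightarrow> bool" where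
  "definable n p \<longleftrightarrow> fv p \<subseteq> {..<n}"

definition is_product :: "space \<Rightarrow> space \<Rightarrow> space \<Rightarrow> fm \<Rightarrow> fm \<Rightarrow> bool" where
  "is_product P A B p q \<longleftrightarrow>
    (CZF \<turnstile> formal_topology A) \<and> (CZF \<turnstile> formal_topology B) \<and> (CZF \<turnstile> formal_topology P) \<and>
    definable 1 p \<and> definable 1 q \<and>
    (CZF \<turnstile> (\<^bold>\<exists>\<^bold>!f. sch p [f])) \<and> (CZF \<turnstile> (\<^bold>\<forall>f. sch p [f] \<^bold>\<longrightarrow> morphism A P f)) \<and>
    (CZF \<turnstile> (\<^bold>\<exists>\<^bold>!g. sch q [g])) \<and> (CZF \<turnstile> (\<^bold>\<forall>g. sch q [g] \<^bold>\<longrightarrow> morphism B P g)) \<and>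
    (\<forall>s c. let T = space_of s c in
      CZF \<turnstile> formal_topology T \<^bold>\<longrightarrow>
        (\<^bold>\<forall>p1. \<^bold>\<forall>p2. sch p [p1] \<^bold>\<and> sch q [p2] \<^bold>\<longrightarrow>
        (\<^bold>\<forall>f. \<^bold>\<forall>g. morphism A T f \<^bold>\<and> morphism B T g \<^bold>\<longrightarrow>
        (\<^bold>\<exists>h. (morphism P T h \<^bold>\<and> mor_eq A T (mor_comp h p1) (val_at f) \<^bold>\<and> mor_eq B T (mor_comp h p2) (val_at g)) \<^bold>\<and>
          (\<^bold>\<forall>k. morphism P T k \<^bold>\<and> mor_eq A T (mor_comp k p1) (val_at f) \<^bold>\<and> mor_eq B T (mor_comp k p2) (val_at g) \<^bold>\<longrightarrow>
            mor_eq P T (val_at k) (val_at h))))))"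

section \<open>The two spaces\<close>

text \<open>The set \<open>{\<top>}\<close> with \<open>\<top> = \<emptyset>\<close>.\<close>

definition pow_notnot :: space where
  "pow_notnot = \<lparr>pts = is_zero, cov = (\<lambda>a u. \<^bold>\<not> \<^bold>\<not> a \<^bold>\<in> u)\<rparr>"

text \<open>The set \<open>{0, 1}\<close> with \<open>0 = \<emptyset>\<close> and \<open>1 = {\<emptyset>}\<close>.\<close>

definition pts_DM :: cls where
  "pts_DM x = (is_zero x \<^bold>\<or> is_one x)"

definition le_DM :: "var \<Rightarrow> var \<Rightarrow> form" where
  "le_DM x y = (x \<^bold>= y \<^bold>\<or> (is_zero x \<^bold>\<and> is_one y))"

definition S_DM :: space where
  "S_DM =
    \<lparr>pts = pts_DM,
     cov = (\<lambda>a u. \<^bold>\<forall>y. pts_DM y \<^bold>\<longrightarrow> (\<^bold>\<forall>x. x \<^bold>\<in> u \<^bold>\<longrightarrow> le_DM x y) \<^bold>\<longrightarrow> le_DM a y)\<rparr>"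

definition predicatively_definable_product :: "space \<Rightarrow> space \<Rightarrow> bool" where
  "predicatively_definable_product A B \<longleftrightarrow>
    (\<exists>s c p q. definable 1 s \<and> definable 2 c \<and> is_product (space_of s c) A B p q)"

end

theory Submission
  imports Defs "HOL-Library.Countable" "HOL-Library.Infinite_Set"
begin

text \<open>
  A morphism \<open>f\<close> of formal topologies satisfies \<open>f(S) = T\<close> and preserves covers.  In \<open>S_DM\<close> the point
  \<open>0\<close> is covered by the empty set, and \<open>1\<close> is covered by \<open>u\<close> iff not not \<open>1 \<in> u\<close>; apart from the
  empty-covered point it is therefore the same space as \<open>pow_notnot\<close>.  In both spaces every point is
  covered by the empty set or covers, as a singleton, the whole space.  So \<open>f(a)\<close> is empty or all of
  \<open>T\<close> up to mutual covering, whatever \<open>f\<close> is: two morphisms to the same space are equal, and the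
  space is its own square with the identity as both projections.

  Derivability in CZF is obtained from completeness for Kripke models whose worlds are saturated
  theories: a formula forced at all worlds of all Kripke models of CZF is derivable, and in a single
  world conjunction, disjunction and existence may be treated classically.
\<close>

section \<open>Derivations\<close>

text \<open>Both spaces are subterminal objects of FSp: every space has at most one arrow into them,
  and an object with this property is its own square. The locale \<open>notnot_space\<close> treats
  them together: for the first space \<open>R\<close> is empty and \<open>U\<close> holds of the
  only point, for the second \<open>R\<close> holds of 0 and \<open>U\<close> of 1. The case
  distinction between \<open>R\<close> and \<open>U\<close> at a world is backed by membership in
  the base being a disjunction. Two obstacles shape the rest. Covering by a class includes the claim
  that the class is a set, and CZF separates only by bounded formulas; so \<open>R\<close> and the
  base are required to be sets, and classes involving the covering are rewritten as bounded formulas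
  in these sets before they are separated. Moreover the universal property concerns every test space
  given by formulas with parameters. In a Kripke model such a space is just a pair of predicates
  that are persistent and respect equality, and one argument about worlds serves all of
  them.\<close>

lemma lift_comp: "lift r \<circ> lift s = lift (r \<circ> s)"
proof
  show "(lift r \<circ> lift s) i = lift (r \<circ> s) i" for i by (cases i) auto
qed

lemma ren_ren: "ren r (ren s p) = ren (r \<circ> s) p"
  by (induction p arbitrary: r s) (auto simp: lift_comp)

lemma ren_cong: "(\<And>i. i \<in> fv p \<Longrightarrow> r i = s i) \<Longrightarrow> ren r p = ren s p"
proof (induction p arbitrary: r s)
  case (Forall p)
  have "lift r i = lift s i" if "i \<in> fv p" for i
    using that Forall.prems by (cases i) auto
  then show ?case by (simp add: Forall.IH[of "lift r" "lift s"])
next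
  case (Exists p)
  have "lift r i = lift s i" if "i \<in> fv p" for i
    using that Exists.prems by (cases i) auto
  then show ?case by (simp add: Exists.IH[of "lift r" "lift s"])
next
  case (Conj p q)
  show ?case using Conj.IH[of r s] Conj.prems by simp
next
  case (Disj p q)
  show ?case using Disj.IH[of r s] Disj.prems by simp
next
  case (Imp p q)
  show ?case using Imp.IH[of r s] Imp.prems by simp
qed simp_all

lemma ren_ident: "(\<And>i. i \<in> fv p \<Longrightarrow> r i = i) \<Longrightarrow> ren r p = p"
proof (induction p arbitrary: r)
  case (Forall p)
  have "lift r i = i" if "i \<in> fv p" for i
    using that Forall.prems by (cases i) auto
  then show ?case by (simp add: Forall.IH[of "lift r"])
next
  case (Exists p)
  have "lift r i = i" if "i \<in> fv p" for i
    using that Exists.prems by (cases i) auto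
  then show ?case by (simp add: Exists.IH[of "lift r"])
qed auto

lemma Suc_mem_lift_image: "{i. Suc i \<in> lift r ` A} = r ` {i. Suc i \<in> A}"
proof -
  have "Suc i \<in> lift r ` A \<longleftrightarrow> (\<exists>j. Suc j \<in> A \<and> i = r j)" for i
  proof
    assume "Suc i \<in> lift r ` A"
    then obtain k where "k \<in> A" "Suc i = lift r k" by auto
    then show "\<exists>j. Suc j \<in> A \<and> i = r j" by (cases k) auto
  qed (force intro: image_eqI[where x = "Suc _"])
  then show ?thesis by auto
qed

lemma fv_ren: "fv (ren r p) = r ` fv p"
  by (induction p arbitrary: r) (auto simp: Suc_mem_lift_image image_Un)

lemma finite_fv: "finite (fv p)"
proof (induction p)
  case (Forall p)
  then show ?case using finite_vimageI[of "fv p" Suc] by (simp add: vimage_def)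
next
  case (Exists p)
  then show ?case using finite_vimageI[of "fv p" Suc] by (simp add: vimage_def)
qed auto

lemma ren_inst: "ren r (inst p t) = inst (ren (lift r) p) (r t)"
  unfolding inst_def ren_ren by (rule ren_cong) (auto split: nat.split)

lemma fv_inst_subset: "fv (inst p t) \<subseteq> insert t (fv (Exists p))"
  unfolding inst_def fv_ren by (auto split: nat.split)

text \<open>Comparing the hypotheses as sets covers weakening, exchange and contraction at once, so
  lists of hypotheses behave like finite sets from here on.\<close>

lemma derives_weaken: "derives Ax G p \<Longrightarrow> set G \<subseteq> set H \<Longrightarrow> derives Ax H p"
proof (induction arbitrary: H rule: derives.induct)
  case (hyp p G)
  then show ?case by (intro derives.hyp) auto
next
  case (DisjE G p q s)
  show ?case
    by (rule derives.DisjE[OF DisjE.IH(1)[OF DisjE.prems]]; rule DisjE.IH; use DisjE.prems in auto)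
next
  case (ImpI p G q)
  have "derives Ax (p # H) q" using ImpI.prems by (intro ImpI.IH) auto
  then show ?case by (rule derives.ImpI)
next
  case (ImpE G p q)
  show ?case by (rule derives.ImpE[OF ImpE.IH(1)[OF ImpE.prems] ImpE.IH(2)[OF ImpE.prems]])
next
  case (ForallI G p)
  then show ?case by (intro derives.ForallI) (auto simp: image_mono)
next
  case (ExistsE G p q)
  have "derives Ax (p # map (ren Suc) H) (ren Suc q)"
    using ExistsE.prems by (intro ExistsE.IH(2)) auto
  then show ?case by (rule derives.ExistsE[OF ExistsE.IH(1)[OF ExistsE.prems]])
next
  case (EqE G i j p)
  show ?case by (rule derives.EqE[OF EqE.IH(1)[OF EqE.prems] EqE.IH(2)[OF EqE.prems]])
next
  case (ConjE1 G p q)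
  show ?case by (rule derives.ConjE1[OF ConjE1.IH[OF ConjE1.prems]])
next
  case (ConjE2 G p q)
  show ?case by (rule derives.ConjE2[OF ConjE2.IH[OF ConjE2.prems]])
next
  case (ForallE G p t)
  show ?case by (rule derives.ForallE[OF ForallE.IH[OF ForallE.prems]])
next
  case (ExistsI G p t)
  show ?case by (rule derives.ExistsI[OF ExistsI.IH[OF ExistsI.prems]])
next
  case (BotE G p)
  show ?case by (rule derives.BotE[OF BotE.IH[OF BotE.prems]])
qed (simp_all add: derives.ax derives.ConjI derives.DisjI1 derives.DisjI2 derives.EqI)

text \<open>The eigenvariable rules do not shift the axioms, so renaming a derivation renames the
  axioms that it uses. Closure under renaming is what \<open>derives_ren\<close> asks for in the
  case of rule \<open>ax\<close>.\<close>

locale axioms =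
  fixes Ax :: "fm set"
  assumes ren_Ax: "p \<in> Ax \<Longrightarrow> ren r p \<in> Ax"
begin

lemma derives_ren: "derives Ax G p \<Longrightarrow> derives Ax (map (ren r) G) (ren r p)"
proof (induction arbitrary: r rule: derives.induct)
  case (ForallI G p)
  have "map (ren (lift r)) (map (ren Suc) G) = map (ren Suc) (map (ren r) G)"
    by (simp add: ren_ren comp_def)
  then show ?case using ForallI.IH[of "lift r"] by (metis derives.ForallI ren.simps(7))
next
  case (ForallE G p t)
  show ?case using derives.ForallE[OF ForallE.IH[of r, simplified]] by (simp add: ren_inst)
next
  case (ExistsI G p t)
  show ?case using derives.ExistsI[OF ExistsI.IH[of r, unfolded ren_inst]] by simp
next
  case (ExistsE G p q)
  have "map (ren (lift r)) (map (ren Suc) G) = map (ren Suc) (map (ren r) G)"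
    "ren (lift r) (ren Suc q) = ren Suc (ren r q)"
    by (simp_all add: ren_ren comp_def)
  then have "derives Ax (ren (lift r) p # map (ren Suc) (map (ren r) G)) (ren Suc (ren r q))"
    using ExistsE.IH(2)[of "lift r"] by (simp only: list.map)
  then show ?case by (rule derives.ExistsE[OF ExistsE.IH(1)[of r, simplified]])
next
  case (EqE G i j p)
  show ?case
    using derives.EqE[OF EqE.IH(1)[of r, simplified] EqE.IH(2)[of r, unfolded ren_inst]]
    by (simp add: ren_inst)
next
  case (DisjE G p q s)
  show ?case
    by (rule derives.DisjE[OF DisjE.IH(1)[of r, simplified]]) (use DisjE.IH(2,3)[of r] in simp_all)
next
  case (ImpE G p q)
  show ?case by (rule derives.ImpE[OF ImpE.IH(1)[of r, simplified] ImpE.IH(2)[of r]])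
next
  case (ConjE1 G p q)
  show ?case by (rule derives.ConjE1[OF ConjE1.IH[of r, simplified]])
next
  case (ConjE2 G p q)
  show ?case by (rule derives.ConjE2[OF ConjE2.IH[of r, simplified]])
next
  case (BotE G p)
  show ?case by (rule derives.BotE[OF BotE.IH[of r, simplified]])
qed (simp_all add: derives.hyp derives.ax ren_Ax derives.ConjI derives.DisjI1 derives.DisjI2
       derives.ImpI derives.EqI)

section \<open>Consequences of infinite theories\<close>

definition entails :: "fm set \<Rightarrow> fm \<Rightarrow> bool" where
  "entails \<Gamma> p \<longleftrightarrow> (\<exists>G. set G \<subseteq> \<Gamma> \<and> derives Ax G p)"

lemma entails_hyp: "p \<in> \<Gamma> \<Longrightarrow> entails \<Gamma> p"
  unfolding entails_def by (rule exI[of _ "[p]"]) (simp add: hyp)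

lemma entails_mono: "entails \<Gamma> p \<Longrightarrow> \<Gamma> \<subseteq> \<Delta> \<Longrightarrow> entails \<Delta> p"
  unfolding entails_def by blast

lemma entails_ImpE:
  assumes "entails \<Gamma> (Imp p q)" "entails \<Gamma> p"
  shows "entails \<Gamma> q"
proof -
  obtain G H where GH: "set G \<subseteq> \<Gamma>" "derives Ax G (Imp p q)" "set H \<subseteq> \<Gamma>" "derives Ax H p"
    using assms unfolding entails_def by blast
  have "derives Ax (G @ H) q"
    by (rule derives.ImpE[OF derives_weaken[OF GH(2)] derives_weaken[OF GH(4)]]) auto
  then show ?thesis unfolding entails_def using GH by (intro exI[of _ "G @ H"]) simp
qed

text \<open>Each hypothesis is discharged by \<open>ImpI\<close> and supplied again by modus ponens.
  Rules for theories thus reduce to derivations from a short explicit list.\<close>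

lemma entails_cut: "derives Ax G p \<Longrightarrow> (\<And>g. g \<in> set G \<Longrightarrow> entails \<Gamma> g) \<Longrightarrow> entails \<Gamma> p"
proof (induction G arbitrary: p)
  case Nil
  then show ?case unfolding entails_def by (intro exI[of _ "[]"]) auto
next
  case (Cons g G)
  have "entails \<Gamma> (Imp g p)"
    using Cons.prems(2) by (intro Cons.IH[OF derives.ImpI[OF Cons.prems(1)]]) simp
  then show ?case by (rule entails_ImpE) (simp add: Cons.prems)
qed

lemma entails_insertE:
  assumes "entails (insert p \<Gamma>) q"
  obtains G where "set G \<subseteq> \<Gamma>" "derives Ax (p # G) q"
proof -
  obtain G where G: "set G \<subseteq> insert p \<Gamma>" "derives Ax G q"
    using assms unfolding entails_def by blast
  show ?thesis
  proof (rule that)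
    show "set (filter (\<lambda>g. g \<noteq> p) G) \<subseteq> \<Gamma>" using G by auto
    show "derives Ax (p # filter (\<lambda>g. g \<noteq> p) G) q" by (rule derives_weaken[OF G(2)]) auto
  qed
qed

lemma entails_ImpI: "entails (insert p \<Gamma>) q \<Longrightarrow> entails \<Gamma> (Imp p q)"
  by (erule entails_insertE) (use derives.ImpI entails_def in blast)

lemma entails_DisjE:
  assumes "entails \<Gamma> (Disj p q)" "entails (insert p \<Gamma>) s" "entails (insert q \<Gamma>) s"
  shows "entails \<Gamma> s"
proof -
  have "derives Ax [Imp p s, Imp q s, Disj p q] s"
    by (rule derives.DisjE[of _ _ p q]; (rule derives.ImpE[of _ _ p s] derives.ImpE[of _ _ q s])?;
        simp add: derives.hyp)
  then show ?thesis by (rule entails_cut) (use assms in \<open>auto intro: entails_ImpI\<close>)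
qed

text \<open>Renaming the fresh variable \<open>c\<close> to \<open>0\<close> and shifting the others turns a derivation about
  \<open>c\<close> into the premise of an eigenvariable rule.\<close>

definition eigen :: "nat \<Rightarrow> nat \<Rightarrow> nat" where
  "eigen c i = (if i = c then 0 else Suc i)"

lemma ren_eigen: "c \<notin> fv p \<Longrightarrow> ren (eigen c) p = ren Suc p"
  by (rule ren_cong) (auto simp: eigen_def)

lemma ren_eigen_inst: "c \<notin> fv (Exists p) \<Longrightarrow> ren (eigen c) (inst p c) = p"
  unfolding inst_def ren_ren by (rule ren_ident) (auto simp: eigen_def split: nat.split)

lemma entails_ForallI:
  assumes "entails \<Gamma> (inst p c)" "c \<notin> fv (Forall p)" "\<And>g. g \<in> \<Gamma> \<Longrightarrow> c \<notin> fv g"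
  shows "entails \<Gamma> (Forall p)"
proof -
  obtain G where G: "set G \<subseteq> \<Gamma>" "derives Ax G (inst p c)"
    using assms unfolding entails_def by blast
  have "map (ren (eigen c)) G = map (ren Suc) G"
    using G assms by (auto intro!: ren_eigen)
  moreover have "ren (eigen c) (inst p c) = p"
    using assms by (simp add: ren_eigen_inst)
  ultimately have "derives Ax (map (ren Suc) G) p"
    using derives_ren[OF G(2), of "eigen c"] by metis
  then show ?thesis using G unfolding entails_def by (blast intro: derives.ForallI)
qed

lemma entails_ExistsE:
  assumes "entails \<Gamma> (Exists p)" "entails (insert (inst p c) \<Gamma>) q"
    and "c \<notin> fv (Exists p)" "\<And>g. g \<in> \<Gamma> \<Longrightarrow> c \<notin> fv g" "c \<notin> fv q"
  shows "entails \<Gamma> q"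
proof -
  obtain G where G: "set G \<subseteq> \<Gamma>" "derives Ax (inst p c # G) q"
    using assms(2) by (rule entails_insertE)
  have "map (ren (eigen c)) G = map (ren Suc) G"
    using G assms by (auto intro!: ren_eigen)
  moreover have "ren (eigen c) (inst p c) = p" "ren (eigen c) q = ren Suc q"
    using assms by (simp_all add: ren_eigen_inst ren_eigen)
  ultimately have "derives Ax (p # map (ren Suc) G) (ren Suc q)"
    using derives_ren[OF G(2), of "eigen c"] by (metis list.map(2))
  \<comment> \<open>\<open>Exists p\<close> joins the hypotheses so that the rule finds its major
    premise there; afterwards \<open>Exists p\<close> and \<open>G\<close> are cut together.\<close>
  then have "derives Ax (p # map (ren Suc) (Exists p # G)) (ren Suc q)"
    by (rule derives_weaken) auto
  then have "derives Ax (Exists p # G) q"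
    by (intro derives.ExistsE[of Ax "Exists p # G" p q]) (simp_all add: derives.hyp)
  then show ?thesis by (rule entails_cut) (use G assms(1) in \<open>auto intro: entails_hyp\<close>)
qed

subsection \<open>Saturated theories\<close>

text \<open>\<open>V\<close> holds the variables that act as constants of the theory. Infinitely
  many variables stay outside as a supply for further extensions, and \<open>V\<close> is nonempty
  because it becomes the domain of a world.\<close>

definition saturated :: "nat set \<Rightarrow> fm set \<Rightarrow> bool" where
  "saturated V w \<longleftrightarrow> infinite (- V) \<and> V \<noteq> {} \<and> (\<forall>p\<in>w. fv p \<subseteq> V) \<and>
    (\<forall>p. entails w p \<longrightarrow> fv p \<subseteq> V \<longrightarrow> p \<in> w) \<and> Bot \<notin> w \<and>
    (\<forall>p q. Disj p q \<in> w \<longrightarrow> p \<in> w \<or> q \<in> w) \<and>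
    (\<forall>p. Exists p \<in> w \<longrightarrow> (\<exists>c\<in>V. inst p c \<in> w))"

end

instance fm :: countable by countable_datatype

lemma split_infinite:
  fixes A :: "nat set"
  assumes "infinite A"
  obtains B where "B \<subseteq> A" "infinite B" "infinite (A - B)"
proof
  let ?e = "enumerate A"
  have inj: "inj ?e" using assms by (simp add: strict_mono_enumerate strict_mono_imp_inj_on)
  show "range (\<lambda>n. ?e (2 * n)) \<subseteq> A"
    using assms by (auto simp: enumerate_in_set)
  show "infinite (range (\<lambda>n. ?e (2 * n)))"
    by (intro range_inj_infinite injI) (simp add: inj_eq[OF inj])
  have "range (\<lambda>n. ?e (2 * n + 1)) \<subseteq> A - range (\<lambda>n. ?e (2 * n))"
    using assms inj by (auto simp: enumerate_in_set inj_eq) presburger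
  moreover have "infinite (range (\<lambda>n. ?e (2 * n + 1)))"
    by (intro range_inj_infinite injI) (simp add: inj_eq[OF inj])
  ultimately show "infinite (A - range (\<lambda>n. ?e (2 * n)))"
    using finite_subset by blast
qed

context axioms
begin

text \<open>One Henkin step, for the formula \<open>f\<close>. If each disjunct of a derivable
  disjunction led to \<open>q\<close>, then so would the disjunction, hence one of them may be
  added. For an existential formula a fresh witness exists because only the finite list
  \<open>G\<close> has used variables of \<open>V' - V\<close>.\<close>

lemma saturation_step:
  assumes ent: "\<not> entails (\<Gamma> \<union> set G) q"
    and fv: "\<And>p. p \<in> \<Gamma> \<Longrightarrow> fv p \<subseteq> V" "fv q \<subseteq> V" "V \<subseteq> V'" "infinite (V' - V)"
    and G: "\<forall>p\<in>set G. fv p \<subseteq> V'"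
  shows "\<exists>H. (\<forall>p\<in>set H. fv p \<subseteq> V') \<and> \<not> entails (\<Gamma> \<union> set H) q \<and> set G \<subseteq> set H \<and>
    (entails (\<Gamma> \<union> set G) f \<longrightarrow> fv f \<subseteq> V' \<longrightarrow>
      (\<forall>a b. f = Disj a b \<longrightarrow> a \<in> set H \<or> b \<in> set H) \<and>
      (\<forall>a. f = Exists a \<longrightarrow> (\<exists>c\<in>V'. inst a c \<in> set H)))"
proof (cases "entails (\<Gamma> \<union> set G) f \<and> fv f \<subseteq> V'")
  case True
  consider a b where "f = Disj a b" | a where "f = Exists a"
    | "(\<forall>a b. f \<noteq> Disj a b) \<and> (\<forall>a. f \<noteq> Exists a)" by blast
  then show ?thesis
  proof cases
    case (1 a b)
    then have "\<not> entails (insert a (\<Gamma> \<union> set G)) q \<or> \<not> entails (insert b (\<Gamma> \<union> set G)) q"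
      using True ent entails_DisjE by blast
    then obtain c where "c = a \<or> c = b" "\<not> entails (insert c (\<Gamma> \<union> set G)) q" by blast
    then show ?thesis using 1 True G by (intro exI[of _ "c # G"]) auto
  next
    case (2 a)
    have "finite (fv f \<union> (\<Union>p\<in>set G. fv p))" by (simp add: finite_fv)
    then have "infinite (V' - V - (fv f \<union> (\<Union>p\<in>set G. fv p)))"
      using fv by (metis Diff_infinite_finite)
    then obtain c where c: "c \<in> V' - V - (fv f \<union> (\<Union>p\<in>set G. fv p))"
      by (metis finite.emptyI ex_in_conv)
    have "\<not> entails (insert (inst a c) (\<Gamma> \<union> set G)) q"
    proof
      assume "entails (insert (inst a c) (\<Gamma> \<union> set G)) q"
      moreover have "c \<notin> fv (Exists a)" using c 2 by blast
      moreover have "\<And>g. g \<in> \<Gamma> \<union> set G \<Longrightarrow> c \<notin> fv g" using c fv by blast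
      moreover have "c \<notin> fv q" using c fv by blast
      ultimately show False using entails_ExistsE True 2 ent by blast
    qed
    moreover have "fv (inst a c) \<subseteq> V'"
      using fv_inst_subset[of a c] c True 2 by blast
    ultimately show ?thesis using 2 True G c by (intro exI[of _ "inst a c # G"]) auto
  next
    case 3
    then show ?thesis using G ent by (intro exI[of _ G]) auto
  qed
next
  case False
  then show ?thesis using G ent by (intro exI[of _ G]) auto
qed

lemma saturated_extension:
  assumes ent: "\<not> entails \<Gamma> q" and V: "infinite (- V)" "V \<noteq> {}"
    and fv: "\<And>p. p \<in> \<Gamma> \<Longrightarrow> fv p \<subseteq> V" "fv q \<subseteq> V"
  obtains V' w where "saturated V' w" "V \<subseteq> V'" "\<Gamma> \<subseteq> w" "q \<notin> w"
proof -
  obtain B where B: "B \<subseteq> - V" "infinite B" "infinite (- V - B)"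
    using split_infinite V(1) by blast
  define V' where "V' = V \<union> B"
  have V': "V \<subseteq> V'" "infinite (V' - V)" "infinite (- V')"
  proof -
    have "V' - V = B" "- V' = - V - B" using B by (auto simp: V'_def)
    then show "infinite (V' - V)" "infinite (- V')" using B by auto
  qed (auto simp: V'_def)
  \<comment> \<open>The pairing makes every formula occur at infinitely many stages: a disjunction
    or existential formula may become derivable only late, and it must be treated after that. The
    fact \<open>later\<close> below relies on this.\<close>
  define f :: "nat \<Rightarrow> fm" where "f n = from_nat (fst (prod_decode n))" for n
  have f: "\<exists>n\<ge>m. f n = p" for m p
    by (rule exI[of _ "prod_encode (to_nat p, m)"]) (auto simp: f_def le_prod_encode_2)
  let ?P = "\<lambda>(n::nat) G. (\<forall>p\<in>set G. fv p \<subseteq> V') \<and> \<not> entails (\<Gamma> \<union> set G) q"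
  let ?Q = "\<lambda>n G H. set G \<subseteq> set H \<and> (entails (\<Gamma> \<union> set G) (f n) \<longrightarrow> fv (f n) \<subseteq> V' \<longrightarrow>
      (\<forall>a b. f n = Disj a b \<longrightarrow> a \<in> set H \<or> b \<in> set H) \<and>
      (\<forall>a. f n = Exists a \<longrightarrow> (\<exists>c\<in>V'. inst a c \<in> set H)))"
  have "\<exists>G. \<forall>n. ?P n (G n) \<and> ?Q n (G n) (G (Suc n))"
  proof (rule dependent_nat_choice[where P = ?P and Q = ?Q])
    show "\<exists>G. ?P 0 G" using ent by (intro exI[of _ "[]"]) auto
  next
    fix G n assume "?P n G"
    then show "\<exists>H. ?P (Suc n) H \<and> ?Q n G H"
      unfolding conj_assoc by (intro saturation_step[where V = V] fv V'(1,2)) blast+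
  qed
  then obtain G where G: "\<forall>n. ?P n (G n) \<and> ?Q n (G n) (G (Suc n))" ..
  have P: "?P n (G n)" and Q: "?Q n (G n) (G (Suc n))" for n
    using G[rule_format, of n] by (rule conjunct1, rule conjunct2)
  have mono: "set (G m) \<subseteq> set (G n)" if "m \<le> n" for m n
    using conjunct1[OF Q] that by (rule lift_Suc_mono_le[of "\<lambda>n. set (G n)"])
  define w where "w = {p. fv p \<subseteq> V' \<and> (\<exists>n. entails (\<Gamma> \<union> set (G n)) p)}"
  \<comment> \<open>The stages increase, so finitely many members of \<open>w\<close> are entailed
    at a common stage; this makes \<open>w\<close> deductively closed.\<close>
  have stage: "\<exists>n. \<forall>p\<in>set L. entails (\<Gamma> \<union> set (G n)) p" if "set L \<subseteq> w" for L
    using that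
  proof (induction L)
    case (Cons p L)
    then obtain n m where nm: "entails (\<Gamma> \<union> set (G n)) p" "\<forall>p\<in>set L. entails (\<Gamma> \<union> set (G m)) p"
      by (auto simp: w_def)
    have "\<Gamma> \<union> set (G n) \<subseteq> \<Gamma> \<union> set (G (max n m))" "\<Gamma> \<union> set (G m) \<subseteq> \<Gamma> \<union> set (G (max n m))"
      using mono[of n "max n m"] mono[of m "max n m"] by auto
    then show ?case using nm entails_mono by (intro exI[of _ "max n m"]) auto
  qed auto
  have closed: "\<exists>n. entails (\<Gamma> \<union> set (G n)) p" if "entails w p" for p
    using that stage entails_cut unfolding entails_def[of w] by meson
  have later: "\<exists>n. entails (\<Gamma> \<union> set (G n)) p \<and> f n = p" if p: "p \<in> w" for p
  proof -
    obtain m where "entails (\<Gamma> \<union> set (G m)) p" using p by (auto simp: w_def)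
    moreover obtain n where n: "n \<ge> m" "f n = p" using f by blast
    ultimately show ?thesis using entails_mono[of "\<Gamma> \<union> set (G m)" p "\<Gamma> \<union> set (G n)"] mono[OF n(1)]
      by blast
  qed
  have in_w: "p \<in> w" if "p \<in> set (G n)" for p n
    using that P[of n] by (auto simp: w_def intro: entails_hyp)
  have "q \<notin> w" using P by (auto simp: w_def)
  moreover have "\<Gamma> \<subseteq> w" using fv V' by (auto simp: w_def intro: entails_hyp)
  moreover have "saturated V' w"
    unfolding saturated_def
  proof (intro conjI allI impI)
    show "V' \<noteq> {}" using V by (auto simp: V'_def)
    show "\<forall>p\<in>w. fv p \<subseteq> V'" by (auto simp: w_def)
    show "p \<in> w" if "entails w p" "fv p \<subseteq> V'" for p
      using that closed by (auto simp: w_def)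
    show "Bot \<notin> w"
    proof
      assume "Bot \<in> w"
      then obtain n where "entails (\<Gamma> \<union> set (G n)) Bot" by (auto simp: w_def)
      then have "entails (\<Gamma> \<union> set (G n)) q" unfolding entails_def by (blast intro: BotE)
      then show False using P by blast
    qed
    show "a \<in> w \<or> b \<in> w" if ab: "Disj a b \<in> w" for a b
    proof -
      obtain n where "entails (\<Gamma> \<union> set (G n)) (Disj a b)" "f n = Disj a b"
        using later ab by blast
      moreover have "fv (Disj a b) \<subseteq> V'" using ab by (auto simp: w_def)
      ultimately show ?thesis using Q[of n] in_w by fastforce
    qed
    show "\<exists>c\<in>V'. inst a c \<in> w" if a: "Exists a \<in> w" for a
    proof -
      obtain n where "entails (\<Gamma> \<union> set (G n)) (Exists a)" "f n = Exists a"
        using later a by blast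
      moreover have "fv (Exists a) \<subseteq> V'" using a by (auto simp: w_def)
      ultimately show ?thesis using Q[of n] in_w by fastforce
    qed
  qed (use V' in auto)
  ultimately show ?thesis using that V' by blast
qed

end

section \<open>Kripke semantics\<close>

text \<open>Equality is a congruence that may grow from world to world. In this way variables can
  serve as elements of the canonical model without forming quotients, which would change along the
  order.\<close>

locale kripke =
  fixes le :: "'w \<Rightarrow> 'w \<Rightarrow> bool" (infix "\<sqsubseteq>" 50)
    and D :: "'w \<Rightarrow> 'a set"
    and M :: "'w \<Rightarrow> 'a \<Rightarrow> 'a \<Rightarrow> bool"
    and E :: "'w \<Rightarrow> 'a \<Rightarrow> 'a \<Rightarrow> bool"
  assumes le_refl [simp, intro]: "w \<sqsubseteq> w"
    and le_trans [trans]: "u \<sqsubseteq> v \<Longrightarrow> v \<sqsubseteq> w \<Longrightarrow> u \<sqsubseteq> w"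
    and D_nonempty: "D w \<noteq> {}"
    and D_mono: "v \<sqsubseteq> w \<Longrightarrow> x \<in> D v \<Longrightarrow> x \<in> D w"
    and M_mono: "v \<sqsubseteq> w \<Longrightarrow> M v x y \<Longrightarrow> M w x y"
    and E_mono: "v \<sqsubseteq> w \<Longrightarrow> E v x y \<Longrightarrow> E w x y"
    and M_D: "M w x y \<Longrightarrow> x \<in> D w" "M w x y \<Longrightarrow> y \<in> D w"
    and E_refl [simp, intro]: "E w x x"
    and E_sym: "E w x y \<Longrightarrow> E w y x"
    and E_trans: "E w x y \<Longrightarrow> E w y z \<Longrightarrow> E w x z"
    and M_cong: "E w x x' \<Longrightarrow> E w y y' \<Longrightarrow> M w x y \<Longrightarrow> M w x' y'"
begin

primrec sem :: "'w \<Rightarrow> (nat \<Rightarrow> 'a) \<Rightarrow> fm \<Rightarrow> bool" where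
  "sem w e (Mem i j) = M w (e i) (e j)"
| "sem w e (Eq i j) = E w (e i) (e j)"
| "sem w e Bot = False"
| "sem w e (Conj p q) = (sem w e p \<and> sem w e q)"
| "sem w e (Disj p q) = (sem w e p \<or> sem w e q)"
| "sem w e (Imp p q) = (\<forall>w'. w \<sqsubseteq> w' \<longrightarrow> sem w' e p \<longrightarrow> sem w' e q)"
| "sem w e (Forall p) = (\<forall>w'. w \<sqsubseteq> w' \<longrightarrow> (\<forall>a\<in>D w'. sem w' (case_nat a e) p))"
| "sem w e (Exists p) = (\<exists>a\<in>D w. sem w (case_nat a e) p)"

lemma sem_mono: "v \<sqsubseteq> w \<Longrightarrow> sem v e p \<Longrightarrow> sem w e p"
proof (induction p arbitrary: v w e)
  case (Imp p q)
  then show ?case by (auto intro: le_trans)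
next
  case (Forall p)
  then show ?case by (auto intro: le_trans)
next
  case (Exists p)
  then show ?case by (auto intro: D_mono)
qed (auto intro: M_mono E_mono)

lemma sem_E_cong: "(\<And>i. E w (e i) (e' i)) \<Longrightarrow> sem w e p \<Longrightarrow> sem w e' p"
proof (induction p arbitrary: w e e')
  case (Mem i j)
  then show ?case by (auto intro: M_cong)
next
  case (Eq i j)
  then show ?case by (auto intro: E_trans E_sym)
next
  case (Imp p q)
  show ?case unfolding sem.simps
  proof (intro allI impI)
    fix w' assume w': "w \<sqsubseteq> w'" "sem w' e' p"
    then have E: "E w' (e i) (e' i)" for i using Imp.prems E_mono by blast
    have "sem w' e p" by (rule Imp.IH(1)[OF E_sym[OF E] w'(2)])
    then have "sem w' e q" using Imp.prems(2) w' by auto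
    then show "sem w' e' q" by (rule Imp.IH(2)[OF E])
  qed
next
  case (Forall p)
  show ?case unfolding sem.simps
  proof (intro allI impI ballI)
    fix w' a assume w': "w \<sqsubseteq> w'" "a \<in> D w'"
    then have E: "E w' (case_nat a e i) (case_nat a e' i)" for i
      using Forall.prems E_mono E_refl by (auto split: nat.split)
    show "sem w' (case_nat a e') p"
      by (rule Forall.IH[OF E]) (use Forall.prems w' in auto)
  qed
next
  case (Exists p)
  then obtain a where a: "a \<in> D w" "sem w (case_nat a e) p" by auto
  have E: "E w (case_nat a e i) (case_nat a e' i)" for i
    using Exists.prems E_refl a by (auto split: nat.split)
  show ?case using Exists.IH[OF E a(2)] a by auto
next
  case (Conj p q)
  show ?case using Conj.IH[OF Conj.prems(1)] Conj.prems(2) by simp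
next
  case (Disj p q)
  show ?case using Disj.IH[OF Disj.prems(1)] Disj.prems(2) by auto
qed auto

lemma sem_cong: "(\<And>i. i \<in> fv p \<Longrightarrow> e i = e' i) \<Longrightarrow> sem w e p = sem w e' p"
proof (induction p arbitrary: w e e')
  case (Imp p q)
  show ?case using Imp.IH[of e e'] Imp.prems by simp
next
  case (Conj p q)
  show ?case using Conj.IH[of e e'] Conj.prems by simp
next
  case (Disj p q)
  show ?case using Disj.IH[of e e'] Disj.prems by simp
next
  case (Forall p)
  have "sem w' (case_nat a e) p = sem w' (case_nat a e') p" for w' a
    by (rule Forall.IH) (use Forall.prems in \<open>auto split: nat.split\<close>)
  then show ?case by simp
next
  case (Exists p)
  have "sem w' (case_nat a e) p = sem w' (case_nat a e') p" for w' a
    by (rule Exists.IH) (use Exists.prems in \<open>auto split: nat.split\<close>)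
  then show ?case by simp
qed auto

lemma case_nat_lift: "case_nat a e \<circ> lift r = case_nat a (e \<circ> r)"
proof
  show "(case_nat a e \<circ> lift r) i = case_nat a (e \<circ> r) i" for i by (cases i) auto
qed

lemma sem_ren: "sem w e (ren r p) = sem w (e \<circ> r) p"
  by (induction p arbitrary: w e r) (simp_all add: case_nat_lift)

end

text \<open>Demanding truth in every environment over the domain matches the reading of free
  variables of axioms as universally quantified.\<close>

locale kripke_model = kripke +
  fixes Ax :: "fm set"
  assumes sem_Ax: "p \<in> Ax \<Longrightarrow> (\<And>i. e i \<in> D w) \<Longrightarrow> sem w e p"

subsection \<open>Completeness\<close>

locale canonical_model = axioms +
  fixes V0 :: "nat set" and w0 :: "fm set"
  assumes saturated_0: "saturated V0 w0"
begin

text \<open>Every pair is made to denote a saturated theory, as the worlds of a Kripke model form a type.\<close>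

definition world :: "nat set \<times> fm set \<Rightarrow> nat set \<times> fm set" where
  "world x = (if saturated (fst x) (snd x) then x else (V0, w0))"

definition vars :: "nat set \<times> fm set \<Rightarrow> nat set" where
  "vars x = fst (world x)"

definition thy :: "nat set \<times> fm set \<Rightarrow> fm set" where
  "thy x = snd (world x)"

definition ext :: "nat set \<times> fm set \<Rightarrow> nat set \<times> fm set \<Rightarrow> bool" where
  "ext x y \<longleftrightarrow> vars x \<subseteq> vars y \<and> thy x \<subseteq> thy y"

lemma saturated_thy: "saturated (vars x) (thy x)"
  using saturated_0 by (auto simp: vars_def thy_def world_def)

lemma thy_closed: "entails (thy x) p \<Longrightarrow> fv p \<subseteq> vars x \<Longrightarrow> p \<in> thy x"
  using saturated_thy unfolding saturated_def by blast

lemma thy_fv: "p \<in> thy x \<Longrightarrow> fv p \<subseteq> vars x"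
  using saturated_thy unfolding saturated_def by blast

lemma thy_derives:
  assumes "derives Ax G p" "set G \<subseteq> thy x" "fv p \<subseteq> vars x"
  shows "p \<in> thy x"
  using assms by (intro thy_closed) (auto simp: entails_def)

lemma extension:
  assumes "\<not> entails \<Gamma> q" "infinite (- V)" "V \<noteq> {}" "\<And>p. p \<in> \<Gamma> \<Longrightarrow> fv p \<subseteq> V" "fv q \<subseteq> V"
  obtains y where "V \<subseteq> vars y" "\<Gamma> \<subseteq> thy y" "q \<notin> thy y"
proof -
  obtain V' w where "saturated V' w" "V \<subseteq> V'" "\<Gamma> \<subseteq> w" "q \<notin> w"
    using saturated_extension[OF assms] .
  then show ?thesis by (intro that[of "(V', w)"]) (auto simp: vars_def thy_def world_def)
qed

lemma Conj_thy: "Conj p q \<in> thy x \<longleftrightarrow> p \<in> thy x \<and> q \<in> thy x"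
proof safe
  assume *: "Conj p q \<in> thy x"
  have "derives Ax [Conj p q] p" "derives Ax [Conj p q] q"
    by (rule derives.ConjE1[of _ _ _ q] derives.ConjE2[of _ _ p]; simp add: derives.hyp)+
  then show "p \<in> thy x" "q \<in> thy x" using * thy_fv[OF *] by (auto elim: thy_derives)
next
  assume *: "p \<in> thy x" "q \<in> thy x"
  have "derives Ax [p, q] (Conj p q)" by (rule derives.ConjI) (simp_all add: derives.hyp)
  then show "Conj p q \<in> thy x" using * *[THEN thy_fv] by (elim thy_derives) auto
qed

lemma Disj_thy:
  assumes "fv (Disj p q) \<subseteq> vars x"
  shows "Disj p q \<in> thy x \<longleftrightarrow> p \<in> thy x \<or> q \<in> thy x"
proof
  assume "Disj p q \<in> thy x"
  then show "p \<in> thy x \<or> q \<in> thy x" using saturated_thy unfolding saturated_def by blast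
next
  assume *: "p \<in> thy x \<or> q \<in> thy x"
  have "derives Ax [p] (Disj p q)" "derives Ax [q] (Disj p q)"
    by (simp_all add: derives.DisjI1 derives.DisjI2 derives.hyp)
  then show "Disj p q \<in> thy x" using * assms thy_derives[of "[_]"] by fastforce
qed

text \<open>If the implication is missing, then the theory together with \<open>p\<close> does not
  entail \<open>q\<close>, and a saturated extension that contains \<open>p\<close> but omits
  \<open>q\<close> is the world that refutes it.\<close>

lemma Imp_thy:
  assumes "fv (Imp p q) \<subseteq> vars x"
  shows "Imp p q \<in> thy x \<longleftrightarrow> (\<forall>y. ext x y \<longrightarrow> p \<in> thy y \<longrightarrow> q \<in> thy y)"
proof safe
  fix y assume *: "Imp p q \<in> thy x" "ext x y" "p \<in> thy y"
  have "derives Ax [Imp p q, p] q" by (rule derives.ImpE[of _ _ p]) (simp_all add: derives.hyp)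
  then show "q \<in> thy y" using * assms by (elim thy_derives) (auto simp: ext_def)
next
  assume *: "\<forall>y. ext x y \<longrightarrow> p \<in> thy y \<longrightarrow> q \<in> thy y"
  show "Imp p q \<in> thy x"
  proof (rule ccontr)
    assume "Imp p q \<notin> thy x"
    then have "\<not> entails (insert p (thy x)) q"
      using thy_closed entails_ImpI assms by blast
    then obtain y where "vars x \<subseteq> vars y" "insert p (thy x) \<subseteq> thy y" "q \<notin> thy y"
      by (rule extension[of _ _ "vars x"]) (use saturated_thy[of x] assms in \<open>auto simp: saturated_def\<close>)
    then show False using * by (auto simp: ext_def)
  qed
qed

text \<open>A variable outside \<open>vars x\<close> is generic: if its instance were entailed, the
  universal formula would be too. Otherwise some world has this variable in its domain and omits the
  instance.\<close>

lemma Forall_thy: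
  assumes "fv (Forall p) \<subseteq> vars x"
  shows "Forall p \<in> thy x \<longleftrightarrow> (\<forall>y. ext x y \<longrightarrow> (\<forall>c\<in>vars y. inst p c \<in> thy y))"
proof safe
  fix y c assume *: "Forall p \<in> thy x" "ext x y" "c \<in> vars y"
  have "derives Ax [Forall p] (inst p c)" by (rule derives.ForallE) (simp add: derives.hyp)
  moreover have "fv (inst p c) \<subseteq> vars y"
    using fv_inst_subset[of p c] * assms by (auto simp: ext_def)
  ultimately show "inst p c \<in> thy y" using * by (elim thy_derives) (auto simp: ext_def)
next
  assume *: "\<forall>y. ext x y \<longrightarrow> (\<forall>c\<in>vars y. inst p c \<in> thy y)"
  show "Forall p \<in> thy x"
  proof (rule ccontr)
    assume notin: "Forall p \<notin> thy x"
    have inf: "infinite (- vars x)" using saturated_thy unfolding saturated_def by blast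
    then obtain c where c: "c \<notin> vars x" by (metis ComplD finite.emptyI ex_in_conv)
    have "\<not> entails (thy x) (inst p c)"
    proof
      assume "entails (thy x) (inst p c)"
      then have "entails (thy x) (Forall p)"
        using c assms thy_fv by (elim entails_ForallI) blast+
      then show False using notin assms thy_closed by blast
    qed
    moreover have "infinite (- insert c (vars x))" using inf by (simp add: Compl_insert)
    moreover have "fv (inst p c) \<subseteq> insert c (vars x)"
      using fv_inst_subset[of p c] assms by auto
    ultimately obtain y where "insert c (vars x) \<subseteq> vars y" "thy x \<subseteq> thy y" "inst p c \<notin> thy y"
      by (elim extension[of "thy x" "inst p c" "insert c (vars x)"]) (use thy_fv in blast)+
    then show False using * by (auto simp: ext_def)
  qed
qed

lemma Exists_thy:
  assumes "fv (Exists p) \<subseteq> vars x"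
  shows "Exists p \<in> thy x \<longleftrightarrow> (\<exists>c\<in>vars x. inst p c \<in> thy x)"
proof
  assume "Exists p \<in> thy x"
  then show "\<exists>c\<in>vars x. inst p c \<in> thy x" using saturated_thy unfolding saturated_def by blast
next
  assume "\<exists>c\<in>vars x. inst p c \<in> thy x"
  then obtain c where *: "inst p c \<in> thy x" by blast
  have "derives Ax [inst p c] (Exists p)" by (rule derives.ExistsI[of _ _ _ c]) (simp add: derives.hyp)
  then show "Exists p \<in> thy x" using * assms by (elim thy_derives) auto
qed

abbreviation mem_thy :: "nat set \<times> fm set \<Rightarrow> nat \<Rightarrow> nat \<Rightarrow> bool" where
  "mem_thy x i j \<equiv> Mem i j \<in> thy x"

text \<open>The disjunct \<open>i = j\<close> gives reflexivity also at numbers outside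
  \<open>vars x\<close>, where \<open>Eq i i\<close> cannot belong to the theory;
  \<open>E_refl\<close> is unconditional.\<close>

abbreviation eq_thy :: "nat set \<times> fm set \<Rightarrow> nat \<Rightarrow> nat \<Rightarrow> bool" where
  "eq_thy x i j \<equiv> i = j \<or> Eq i j \<in> thy x"

lemma thy_EqE:
  assumes "Eq i j \<in> thy x" "inst p i \<in> thy x" "fv (inst p j) \<subseteq> vars x"
  shows "inst p j \<in> thy x"
proof -
  have "derives Ax [Eq i j, inst p i] (inst p j)"
    by (rule derives.EqE[of _ _ i j]) (simp_all add: derives.hyp)
  then show ?thesis using assms by (elim thy_derives) auto
qed

sublocale kripke ext vars mem_thy eq_thy
proof
  show "vars w \<noteq> {}" for w using saturated_thy unfolding saturated_def by blast
  have sym: "Eq y x \<in> thy w" if "Eq x y \<in> thy w" for w x y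
  proof -
    have fv: "{x, y} \<subseteq> vars w" using thy_fv[OF that] by simp
    then have "Eq x x \<in> thy w" by (intro thy_derives[of "[]"] derives.EqI) auto
    \<comment> \<open>The template marks by index 0 the occurrence to be replaced; the other
      variable is written \<open>Suc x\<close> because \<open>inst\<close> lowers it by one.\<close>
    then show ?thesis
      using thy_EqE[of x y w "Eq 0 (Suc x)"] that fv by (simp add: inst_def)
  qed
  then show "eq_thy w x y \<Longrightarrow> eq_thy w y x" for w x y by blast
  have "Eq x z \<in> thy w" if "Eq x y \<in> thy w" "Eq y z \<in> thy w" for w x y z
    using thy_EqE[of y z w "Eq (Suc x) 0"] that that[THEN thy_fv] by (simp add: inst_def)
  then show "eq_thy w x y \<Longrightarrow> eq_thy w y z \<Longrightarrow> eq_thy w x z" for w x y z by blast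
  have left: "mem_thy w x' y" if "eq_thy w x x'" "mem_thy w x y" for w x x' y
    using thy_EqE[of x x' w "Mem 0 (Suc y)"] that that(2)[THEN thy_fv] thy_fv[of "Eq x x'" w]
    by (auto simp: inst_def)
  have right: "mem_thy w x y'" if "eq_thy w y y'" "mem_thy w x y" for w x y y'
    using thy_EqE[of y y' w "Mem (Suc x) 0"] that that(2)[THEN thy_fv] thy_fv[of "Eq y y'" w]
    by (auto simp: inst_def)
  show "eq_thy w x x' \<Longrightarrow> eq_thy w y y' \<Longrightarrow> mem_thy w x y \<Longrightarrow> mem_thy w x' y'" for w x x' y y'
    using left right by blast
qed (auto simp: ext_def dest: thy_fv)

lemma inst_ren_lift: "inst (ren (lift e) p) a = ren (case_nat a e) p"
  unfolding inst_def ren_ren by (rule ren_cong) (auto split: nat.split)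

lemma truth: "(\<And>i. e i \<in> vars x) \<Longrightarrow> sem x e p \<longleftrightarrow> ren e p \<in> thy x"
proof (induction p arbitrary: x e)
  case Bot
  then show ?case using saturated_thy unfolding saturated_def by auto
next
  case (Conj p q)
  show ?case using Conj.IH[OF Conj.prems] by (simp add: Conj_thy)
next
  case (Disj p q)
  have "fv (Disj (ren e p) (ren e q)) \<subseteq> vars x" using Disj.prems by (auto simp: fv_ren)
  then show ?case using Disj.IH[OF Disj.prems] by (simp add: Disj_thy)
next
  case (Imp p q)
  have "fv (Imp (ren e p) (ren e q)) \<subseteq> vars x" using Imp.prems by (auto simp: fv_ren)
  moreover have "e i \<in> vars y" if "ext x y" for y i using that Imp.prems by (auto simp: ext_def)
  ultimately show ?case using Imp.IH by (simp add: Imp_thy)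
next
  case (Forall p)
  have "fv (Forall (ren (lift e) p)) \<subseteq> vars x"
    using Forall.prems by (auto simp: fv_ren Suc_mem_lift_image)
  moreover have "sem y (case_nat a e) p \<longleftrightarrow> inst (ren (lift e) p) a \<in> thy y"
    if "ext x y" "a \<in> vars y" for y a
    unfolding inst_ren_lift using that Forall.prems
    by (intro Forall.IH) (auto simp: ext_def split: nat.split)
  ultimately show ?case by (simp add: Forall_thy)
next
  case (Eq i j)
  \<comment> \<open>If the equation holds through the reflexive disjunct of \<open>eq_thy\<close>,
    its formula must still be found in the theory; it is, since \<open>e i\<close> belongs to
    \<open>vars x\<close>.\<close>
  have "Eq (e i) (e i) \<in> thy x"
    using Eq.prems by (intro thy_derives[of "[]"] derives.EqI) auto
  then show ?case by auto
next
  case (Exists p)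
  have "fv (Exists (ren (lift e) p)) \<subseteq> vars x"
    using Exists.prems by (auto simp: fv_ren Suc_mem_lift_image)
  moreover have "sem x (case_nat a e) p \<longleftrightarrow> inst (ren (lift e) p) a \<in> thy x"
    if "a \<in> vars x" for a
    unfolding inst_ren_lift using that Exists.prems
    by (intro Exists.IH) (auto split: nat.split)
  ultimately show ?case by (simp add: Exists_thy)
qed auto

sublocale kripke_model ext vars mem_thy eq_thy Ax
proof
  fix p x and e :: "nat \<Rightarrow> nat"
  assume "p \<in> Ax" and e: "\<And>i. e i \<in> vars x"
  then have "ren e p \<in> thy x"
    by (intro thy_derives[of "[]"] derives.ax ren_Ax) (auto simp: fv_ren)
  then show "sem x e p" using truth[OF e] by simp
qed

end

text \<open>An underivable \<open>p\<close> is omitted by some saturated theory, and at this world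
  of the canonical model \<open>p\<close> is not forced. Validity is requested for the types of the
  canonical model only, since a hypothesis cannot quantify over types.\<close>

theorem (in axioms) completeness:
  assumes valid: "\<And>le (D :: nat set \<times> fm set \<Rightarrow> nat set) M E w e.
    kripke_model le D M E Ax \<Longrightarrow> (\<And>i. e i \<in> D w) \<Longrightarrow> kripke.sem le D M E w e p"
  shows "derives Ax [] p"
proof (rule ccontr)
  assume "\<not> derives Ax [] p"
  then have "\<not> entails {} p" by (auto simp: entails_def)
  \<comment> \<open>Inserting 0 keeps the set of constants nonempty even if \<open>p\<close> is a
    sentence.\<close>
  moreover have "infinite (- insert 0 (fv p))" by (simp add: finite_fv Compl_eq_Diff_UNIV)
  ultimately obtain V w where Vw: "saturated V w" "insert 0 (fv p) \<subseteq> V" "p \<notin> w"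
    by (rule saturated_extension) auto
  interpret canonical_model Ax V w by unfold_locales (rule Vw)
  have w: "vars (V, w) = V" "thy (V, w) = w" using Vw by (simp_all add: vars_def thy_def world_def)
  \<comment> \<open>The environment must stay inside the domain, so it is the identity on
    \<open>V\<close> with default value 0.\<close>
  define e :: "nat \<Rightarrow> nat" where "e i = (if i \<in> V then i else 0)" for i
  have e: "e i \<in> vars (V, w)" for i using Vw w by (auto simp: e_def)
  have "sem (V, w) e p" by (rule valid[OF kripke_model_axioms e])
  moreover have "ren e p = p" by (rule ren_ident) (use Vw in \<open>auto simp: e_def\<close>)
  ultimately show False using truth[OF e] Vw w by simp
qed

section \<open>CZF\<close>

lemma lift_if: "lift r i = (if i = 0 then 0 else Suc (r (i - 1)))"
  by (cases i) auto

lemma bounded_ren: "bounded p \<Longrightarrow> bounded (ren r p)"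
  by (induction arbitrary: r rule: bounded.induct) (auto intro: bounded.intros)

lemmas form_defs = fmem_def feq_def fbot_def fconj_def fdisj_def fimp_def fall_def fex_def fnot_def
  fiff_def fex1_def

text \<open>Renaming an instance of a scheme renames only the parameters of its formula. Each
  variable that the scheme itself binds in the formula is protected by one \<open>lift\<close>: one
  for induction and separation, two for strong collection, three for subset collection.\<close>

lemma ren_ax_set_induction: "ren r (ax_set_induction p 0) = ax_set_induction (ren (lift r) p) 0"
  by (auto simp: ax_set_induction_def form_defs sch_def ren_ren lift_if nth_Cons' intro!: ren_cong)

lemma ren_ax_separation: "ren r (ax_separation p 0) = ax_separation (ren (lift r) p) 0"
  by (auto simp: ax_separation_def is_set_of_def form_defs sch_def ren_ren lift_if nth_Cons' intro!: ren_cong)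

lemma ren_ax_strong_collection:
  "ren r (ax_strong_collection p 0) = ax_strong_collection (ren (lift (lift r)) p) 0"
  by (auto simp: ax_strong_collection_def form_defs sch_def ren_ren lift_if nth_Cons' intro!: ren_cong)

lemma ren_ax_subset_collection:
  "ren r (ax_subset_collection p 0) = ax_subset_collection (ren (lift (lift (lift r))) p) 0"
  by (auto simp: ax_subset_collection_def form_defs sch_def ren_ren lift_if nth_Cons' intro!: ren_cong)

lemma ren_closed_axioms:
  "ren r (ax_extensionality 0) = ax_extensionality 0" "ren r (ax_pairing 0) = ax_pairing 0"
  "ren r (ax_union 0) = ax_union 0" "ren r (ax_infinity 0) = ax_infinity 0"
  by (simp_all add: ax_extensionality_def ax_pairing_def ax_union_def ax_infinity_def is_set_of_def
      el_def upair_def is_inductive_def is_zero_def is_succ_def subcls_def form_defs lift_if)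

interpretation CZF: axioms CZF_axioms
proof
  show "ren r p \<in> CZF_axioms" if "p \<in> CZF_axioms" for r p
    using that bounded_ren unfolding CZF_axioms_def
    by (auto simp: ren_ax_set_induction ren_ax_separation ren_ax_strong_collection
        ren_ax_subset_collection ren_closed_axioms)
qed

section \<open>Interpretation of formulas with named bound variables\<close>

context kripke
begin

text \<open>\<open>v\<close> gives the values of the bound variables by level, \<open>\<rho>\<close> those of the parameters.\<close>

definition sat :: "(nat \<Rightarrow> 'a) \<Rightarrow> 'w \<Rightarrow> nat \<Rightarrow> (nat \<Rightarrow> 'a) \<Rightarrow> form \<Rightarrow> bool" where
  "sat \<rho> w d v F = sem w (\<lambda>i. if i < d then v (d - 1 - i) else \<rho> (i - d)) (F d)"

lemma sat_mem: "x < d \<Longrightarrow> y < d \<Longrightarrow> sat \<rho> w d v (x \<^bold>\<in> y) = M w (v x) (v y)"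
  by (simp add: sat_def fmem_def)

lemma sat_eq: "x < d \<Longrightarrow> y < d \<Longrightarrow> sat \<rho> w d v (x \<^bold>= y) = E w (v x) (v y)"
  by (simp add: sat_def feq_def)

lemma sat_bot: "sat \<rho> w d v \<^bold>\<bottom> = False"
  by (simp add: sat_def fbot_def)

lemma sat_conj: "sat \<rho> w d v (P \<^bold>\<and> Q) = (sat \<rho> w d v P \<and> sat \<rho> w d v Q)"
  by (simp add: sat_def fconj_def)

lemma sat_disj: "sat \<rho> w d v (P \<^bold>\<or> Q) = (sat \<rho> w d v P \<or> sat \<rho> w d v Q)"
  by (simp add: sat_def fdisj_def)

lemma sat_imp: "sat \<rho> w d v (P \<^bold>\<longrightarrow> Q) = (\<forall>w'. w \<sqsubseteq> w' \<longrightarrow> sat \<rho> w' d v P \<longrightarrow> sat \<rho> w' d v Q)"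
  by (simp add: sat_def fimp_def)

text \<open>A binder at depth \<open>d\<close> introduces the variable of level \<open>d\<close>,
  which has index 0 just below it. Pushing a value onto the de Bruijn environment is therefore an
  update at \<open>d\<close>.\<close>

lemma env_upd: "case_nat a (\<lambda>i. if i < d then v (d - 1 - i) else \<rho> (i - d)) =
    (\<lambda>i. if i < Suc d then (v(d := a)) (Suc d - 1 - i) else \<rho> (i - Suc d))"
  by (auto simp: fun_eq_iff split: nat.split)

lemma sat_all: "sat \<rho> w d v (fall P) =
    (\<forall>w'. w \<sqsubseteq> w' \<longrightarrow> (\<forall>a\<in>D w'. sat \<rho> w' (Suc d) (v(d := a)) (P d)))"
  by (simp only: sat_def fall_def sem.simps env_upd)

lemma sat_ex: "sat \<rho> w d v (fex P) = (\<exists>a\<in>D w. sat \<rho> w (Suc d) (v(d := a)) (P d))"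
  by (simp only: sat_def fex_def sem.simps env_upd)

lemma sat_not: "sat \<rho> w d v (\<^bold>\<not> P) = (\<forall>w'. w \<sqsubseteq> w' \<longrightarrow> \<not> sat \<rho> w' d v P)"
  by (simp add: fnot_def sat_imp sat_bot)

lemma sat_iff: "sat \<rho> w d v (P \<^bold>\<longleftrightarrow> Q) = (\<forall>w'. w \<sqsubseteq> w' \<longrightarrow> sat \<rho> w' d v P = sat \<rho> w' d v Q)"
  by (auto simp: fiff_def sat_conj sat_imp)

lemmas sat_simps = sat_mem sat_eq sat_bot sat_conj sat_disj sat_imp sat_all sat_ex sat_not sat_iff

text \<open>A universal quantifier and the connective below it both range over later worlds.
  Transitivity of the order and growing domains merge the two ranges, which keeps the meaning of the
  long formulas readable.\<close>

lemma all_worlds_collapse: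
  "(\<forall>w'. w \<sqsubseteq> w' \<longrightarrow> (\<forall>a\<in>D w'. \<forall>w''. w' \<sqsubseteq> w'' \<longrightarrow> Q w'' a)) \<longleftrightarrow>
   (\<forall>w'. w \<sqsubseteq> w' \<longrightarrow> (\<forall>a\<in>D w'. Q w' a))"
  using le_trans D_mono le_refl by metis

lemma sat_all_imp: "sat \<rho> w d v (\<^bold>\<forall>x. P x \<^bold>\<longrightarrow> Q x) = (\<forall>w'. w \<sqsubseteq> w' \<longrightarrow> (\<forall>a\<in>D w'.
    sat \<rho> w' (Suc d) (v(d := a)) (P d) \<longrightarrow> sat \<rho> w' (Suc d) (v(d := a)) (Q d)))"
  unfolding sat_all sat_imp by (rule all_worlds_collapse)

lemma sat_all_iff: "sat \<rho> w d v (\<^bold>\<forall>x. P x \<^bold>\<longleftrightarrow> Q x) = (\<forall>w'. w \<sqsubseteq> w' \<longrightarrow> (\<forall>a\<in>D w'.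
    sat \<rho> w' (Suc d) (v(d := a)) (P d) = sat \<rho> w' (Suc d) (v(d := a)) (Q d)))"
  unfolding sat_all sat_iff by (rule all_worlds_collapse)

lemma sat_mono: "w \<sqsubseteq> w' \<Longrightarrow> sat \<rho> w d v F \<Longrightarrow> sat \<rho> w' d v F"
  unfolding sat_def by (rule sem_mono)

lemma sat_E_cong: "(\<And>i. E w (v i) (v' i)) \<Longrightarrow> sat \<rho> w d v F \<Longrightarrow> sat \<rho> w d v' F"
  unfolding sat_def by (erule sem_E_cong[rotated]) auto

lemma sat_ex1: "sat \<rho> w d v (fex1 P) = (\<exists>a\<in>D w. sat \<rho> w (Suc d) (v(d := a)) (P d) \<and>
    (\<forall>w'. w \<sqsubseteq> w' \<longrightarrow> (\<forall>b\<in>D w'. sat \<rho> w' (Suc (Suc d)) (v(d := a, Suc d := b)) (P (Suc d)) \<longrightarrow> E w' b a)))"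
  unfolding fex1_def sat_ex sat_conj sat_all_imp by (simp add: sat_eq)

lemma sat_sch: "(\<And>x. x \<in> set xs \<Longrightarrow> x < d) \<Longrightarrow>
  sat \<rho> w d v (sch p xs) = sem w (\<lambda>i. if i < length xs then v (xs ! i) else \<rho> (i - length xs)) p"
  unfolding sat_def sch_def sem_ren by (rule sem_cong) (force dest: nth_mem)

subsection \<open>Classes\<close>

text \<open>In the scope of the binders of levels below \<open>d\<close>, with values \<open>v\<close>, the class \<open>C\<close> denotes \<open>K\<close>.\<close>

definition denotes :: "(nat \<Rightarrow> 'a) \<Rightarrow> nat \<Rightarrow> (nat \<Rightarrow> 'a) \<Rightarrow> cls \<Rightarrow> ('w \<Rightarrow> 'a \<Rightarrow> bool) \<Rightarrow> bool" where
  "denotes \<rho> d v C K \<longleftrightarrow> (\<forall>w d' v' x. d \<le> d' \<longrightarrow> (\<forall>i<d. v' i = v i) \<longrightarrow> x < d' \<longrightarrow>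
    sat \<rho> w d' v' (C x) = K w (v' x))"

lemma denotesI:
  "(\<And>w d' v' x. d \<le> d' \<Longrightarrow> (\<And>i. i < d \<Longrightarrow> v' i = v i) \<Longrightarrow> x < d' \<Longrightarrow> sat \<rho> w d' v' (C x) = K w (v' x)) \<Longrightarrow>
    denotes \<rho> d v C K"
  by (auto simp: denotes_def)

lemma denotesD: "denotes \<rho> d v C K \<Longrightarrow> x < d \<Longrightarrow> sat \<rho> w d v (C x) = K w (v x)"
  by (auto simp: denotes_def)

lemma denotes_weaken:
  "denotes \<rho> d v C K \<Longrightarrow> d \<le> d' \<Longrightarrow> (\<And>i. i < d \<Longrightarrow> v' i = v i) \<Longrightarrow> denotes \<rho> d' v' C K"
  by (auto simp: denotes_def)

lemma denotes_Suc: "denotes \<rho> d v C K \<Longrightarrow> denotes \<rho> (Suc d) (v(d := a)) C K"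
  by (erule denotes_weaken) auto

lemma denotes_at: "denotes \<rho> d v C K \<Longrightarrow> sat \<rho> w (Suc d) (v(d := a)) (C d) = K w a"
  using denotesD[OF denotes_Suc, of \<rho> d v C K d] by simp

lemma denotes_mono: "denotes \<rho> d v C K \<Longrightarrow> w \<sqsubseteq> w' \<Longrightarrow> K w x \<Longrightarrow> K w' x"
  using denotes_at[of \<rho> d v C K _ x] sat_mono by metis

lemma denotes_E_cong:
  assumes "denotes \<rho> d v C K" "E w x y" "K w x"
  shows "K w y"
proof -
  have "sat \<rho> w (Suc d) (v(d := x)) (C d)" using assms by (simp add: denotes_at)
  then have "sat \<rho> w (Suc d) (v(d := y)) (C d)" by (rule sat_E_cong[rotated]) (use assms in auto)
  then show ?thesis using assms by (simp add: denotes_at)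
qed

definition isset :: "'w \<Rightarrow> 'a \<Rightarrow> ('w \<Rightarrow> 'a \<Rightarrow> bool) \<Rightarrow> bool" where
  "isset w z K \<longleftrightarrow> (\<forall>w'. w \<sqsubseteq> w' \<longrightarrow> (\<forall>x\<in>D w'. M w' x z = K w' x))"

definition subcl :: "'w \<Rightarrow> ('w \<Rightarrow> 'a \<Rightarrow> bool) \<Rightarrow> ('w \<Rightarrow> 'a \<Rightarrow> bool) \<Rightarrow> bool" where
  "subcl w K L \<longleftrightarrow> (\<forall>w'. w \<sqsubseteq> w' \<longrightarrow> (\<forall>x\<in>D w'. K w' x \<longrightarrow> L w' x))"

definition elem :: "'a \<Rightarrow> 'w \<Rightarrow> 'a \<Rightarrow> bool" where
  "elem u = (\<lambda>w x. M w x u)"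

definition single :: "'a \<Rightarrow> 'w \<Rightarrow> 'a \<Rightarrow> bool" where
  "single a = (\<lambda>w x. E w x a)"

definition duo :: "'a \<Rightarrow> 'a \<Rightarrow> 'w \<Rightarrow> 'a \<Rightarrow> bool" where
  "duo a b = (\<lambda>w x. E w x a \<or> E w x b)"

definition zero :: "'w \<Rightarrow> 'a \<Rightarrow> bool" where
  "zero w x \<longleftrightarrow> isset w x (\<lambda>_ _. False)"

definition one :: "'w \<Rightarrow> 'a \<Rightarrow> bool" where
  "one w x \<longleftrightarrow> isset w x zero"

definition pair :: "'w \<Rightarrow> 'a \<Rightarrow> 'a \<Rightarrow> 'a \<Rightarrow> bool" where
  "pair w p a b \<longleftrightarrow> isset w p (\<lambda>w z. isset w z (single a) \<or> isset w z (duo a b))"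

lemma sat_is_set_of:
  assumes "denotes \<rho> d v C K" "z < d"
  shows "sat \<rho> w d v (z \<^bold>\<equiv> C) = isset w (v z) K"
  using assms(2) unfolding is_set_of_def isset_def sat_all_iff
  by (simp add: sat_mem denotes_at[OF assms(1)])

lemma sat_subcls:
  assumes "denotes \<rho> d v C K" "denotes \<rho> d v C' L"
  shows "sat \<rho> w d v (C \<^bold>\<subseteq> C') = subcl w K L"
  unfolding subcls_def subcl_def sat_all_imp
  by (simp add: denotes_at[OF assms(1)] denotes_at[OF assms(2)])

lemma denotes_el: "u < d \<Longrightarrow> denotes \<rho> d v (el u) (elem (v u))"
  by (rule denotesI) (simp add: el_def elem_def sat_simps)

lemma denotes_sing: "a < d \<Longrightarrow> denotes \<rho> d v (sing a) (single (v a))"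
  by (rule denotesI) (simp add: sing_def single_def sat_simps)

lemma denotes_upair: "a < d \<Longrightarrow> b < d \<Longrightarrow> denotes \<rho> d v (upair a b) (duo (v a) (v b))"
  by (rule denotesI) (simp add: upair_def duo_def sat_simps)

lemma denotes_is_zero: "denotes \<rho> d v is_zero zero"
  by (rule denotesI) (auto simp: is_zero_def zero_def intro!: sat_is_set_of denotesI simp: sat_bot)

lemma denotes_is_one: "denotes \<rho> d v is_one one"
  by (rule denotesI) (auto simp: is_one_def one_def intro!: sat_is_set_of denotes_is_zero)

lemma sat_is_pair:
  assumes "p < d" "a < d" "b < d"
  shows "sat \<rho> w d v (is_pair p a b) = pair w (v p) (v a) (v b)"
  unfolding is_pair_def pair_def
proof (intro sat_is_set_of denotesI)
  fix w d' v' x assume d': "d \<le> d'" "\<And>i. i < d \<Longrightarrow> v' i = v i" "x < d'"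
  then have "denotes \<rho> d' v' (sing a) (single (v a))" "denotes \<rho> d' v' (upair a b) (duo (v a) (v b))"
    using denotes_sing[of a d' \<rho> v'] denotes_upair[of a d' b \<rho> v'] assms by auto
  then show "sat \<rho> w d' v' (x \<^bold>\<equiv> sing a \<^bold>\<or> x \<^bold>\<equiv> upair a b) =
      (isset w (v' x) (single (v a)) \<or> isset w (v' x) (duo (v a) (v b)))"
    using d' by (simp add: sat_disj sat_is_set_of)
qed (use assms in auto)

subsection \<open>Spaces and morphisms\<close>

text \<open>The meaning may depend on the parameters \<rho> but not on the depth or on other bound
  variables. This accommodates test spaces defined with parameters.\<close>

definition space_denotes ::
  "(nat \<Rightarrow> 'a) \<Rightarrow> space \<Rightarrow> ('w \<Rightarrow> 'a \<Rightarrow> bool) \<Rightarrow> ('w \<Rightarrow> 'a \<Rightarrow> 'a \<Rightarrow> bool) \<Rightarrow> bool" where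
  "space_denotes \<rho> T P Cv \<longleftrightarrow> (\<forall>w d v a. a < d \<longrightarrow> sat \<rho> w d v (pts T a) = P w (v a)) \<and>
    (\<forall>w d v a u. a < d \<longrightarrow> u < d \<longrightarrow> sat \<rho> w d v (cov T a u) = Cv w (v a) (v u))"

lemma sat_pts: "space_denotes \<rho> T P Cv \<Longrightarrow> a < d \<Longrightarrow> sat \<rho> w d v (pts T a) = P w (v a)"
  by (simp add: space_denotes_def)

lemma sat_cov: "space_denotes \<rho> T P Cv \<Longrightarrow> a < d \<Longrightarrow> u < d \<Longrightarrow> sat \<rho> w d v (cov T a u) = Cv w (v a) (v u)"
  by (simp add: space_denotes_def)

lemma denotes_pts: "space_denotes \<rho> T P Cv \<Longrightarrow> denotes \<rho> d v (pts T) P"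
  by (rule denotesI) (simp add: sat_pts)

lemma space_pts_mono: "space_denotes \<rho> T P Cv \<Longrightarrow> w \<sqsubseteq> w' \<Longrightarrow> P w a \<Longrightarrow> P w' a"
  by (rule denotes_mono[OF denotes_pts])

lemma space_pts_cong: "space_denotes \<rho> T P Cv \<Longrightarrow> E w a b \<Longrightarrow> P w a \<Longrightarrow> P w b"
  by (rule denotes_E_cong[OF denotes_pts])

text \<open>Everything that a formula expresses is persistent and respects \<open>E\<close>. To use
  this, the formula is evaluated at levels 0 and 1 of an environment holding \<open>a\<close> and
  \<open>u\<close>; \<open>pair_E_cong\<close> below uses the same device.\<close>

lemma space_cov_mono:
  assumes "space_denotes \<rho> T P Cv" "w \<sqsubseteq> w'" "Cv w a u"
  shows "Cv w' a u"
  using sat_mono[OF assms(2), of \<rho> 2 "case_nat a (\<lambda>_. u)" "cov T 0 1"] assms(3)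
  by (simp add: sat_cov[OF assms(1)])

lemma space_cov_cong:
  assumes "space_denotes \<rho> T P Cv" "E w a b" "E w u u'" "Cv w a u"
  shows "Cv w b u'"
  using sat_E_cong[of w "case_nat a (\<lambda>_. u)" "case_nat b (\<lambda>_. u')" \<rho> 2 "cov T 0 1"] assms(2-)
  by (simp add: sat_cov[OF assms(1)] split: nat.split)

text \<open>
  \<open>sccov\<close>, \<open>scovers\<close>, \<open>sdown\<close>, \<open>sval\<close>, \<open>sim\<close>, \<open>sft\<close> and \<open>smor\<close> are what \<open>ccov\<close>, \<open>covers\<close>, \<open>down\<close>,
  \<open>val_at\<close>, \<open>im\<close>, \<open>formal_topology\<close> and \<open>morphism\<close> mean at a world.
\<close>

definition sccov :: "('w \<Rightarrow> 'a \<Rightarrow> 'a \<Rightarrow> bool) \<Rightarrow> 'w \<Rightarrow> 'a \<Rightarrow> ('w \<Rightarrow> 'a \<Rightarrow> bool) \<Rightarrow> bool" where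
  "sccov Cv w a K \<longleftrightarrow> (\<exists>z\<in>D w. isset w z K \<and> Cv w a z)"

definition scovers :: "('w \<Rightarrow> 'a \<Rightarrow> 'a \<Rightarrow> bool) \<Rightarrow> 'w \<Rightarrow> ('w \<Rightarrow> 'a \<Rightarrow> bool) \<Rightarrow> ('w \<Rightarrow> 'a \<Rightarrow> bool) \<Rightarrow> bool" where
  "scovers Cv w K L \<longleftrightarrow> (\<forall>w'. w \<sqsubseteq> w' \<longrightarrow> (\<forall>c\<in>D w'. K w' c \<longrightarrow> sccov Cv w' c L))"

definition sdown :: "('w \<Rightarrow> 'a \<Rightarrow> bool) \<Rightarrow> ('w \<Rightarrow> 'a \<Rightarrow> 'a \<Rightarrow> bool) \<Rightarrow> ('w \<Rightarrow> 'a \<Rightarrow> bool) \<Rightarrow>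
    ('w \<Rightarrow> 'a \<Rightarrow> bool) \<Rightarrow> 'w \<Rightarrow> 'a \<Rightarrow> bool" where
  "sdown P Cv K L w x \<longleftrightarrow> P w x \<and> (\<exists>u\<in>D w. K w u \<and> sccov Cv w x (single u)) \<and>
    (\<exists>u\<in>D w. L w u \<and> sccov Cv w x (single u))"

definition sval :: "'a \<Rightarrow> 'a \<Rightarrow> 'w \<Rightarrow> 'a \<Rightarrow> bool" where
  "sval f a w x \<longleftrightarrow> (\<exists>y\<in>D w. (\<exists>p\<in>D w. M w p f \<and> pair w p a y) \<and> M w x y)"

definition sim :: "'a \<Rightarrow> ('w \<Rightarrow> 'a \<Rightarrow> bool) \<Rightarrow> 'w \<Rightarrow> 'a \<Rightarrow> bool" where
  "sim f K w x \<longleftrightarrow> (\<exists>a\<in>D w. K w a \<and> sval f a w x)"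

lemma sat_ccov:
  assumes T: "space_denotes \<rho> T P Cv" and K: "denotes \<rho> d v C K" and a: "a < d"
  shows "sat \<rho> w d v (ccov T a C) = sccov Cv w (v a) K"
  using a unfolding ccov_def sccov_def sat_simps
  by (auto simp: sat_is_set_of[OF denotes_Suc[OF K]] sat_cov[OF T])

lemma sat_covers:
  assumes T: "space_denotes \<rho> T P Cv" and K: "denotes \<rho> d v C K" and L: "denotes \<rho> d v C' L"
  shows "sat \<rho> w d v (covers T C C') = scovers Cv w K L"
  unfolding covers_def scovers_def sat_all_imp
  by (simp add: denotes_at[OF K] sat_ccov[OF T denotes_Suc[OF L]])

lemma denotes_down:
  assumes T: "space_denotes \<rho> T P Cv" and K: "denotes \<rho> d v C K" and L: "denotes \<rho> d v C' L"
  shows "denotes \<rho> d v (down T C C') (sdown P Cv K L)"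
proof (rule denotesI)
  fix w d' v' x assume *: "d \<le> d'" "\<And>i. i < d \<Longrightarrow> v' i = v i" "x < d'"
  have "denotes \<rho> d' v' C K" "denotes \<rho> d' v' C' L" using * K L by (auto intro: denotes_weaken)
  moreover have "denotes \<rho> (Suc d') (v'(d' := a)) (sing d') (single a)" for a
    using denotes_sing[of d' "Suc d'" \<rho> "v'(d' := a)"] by simp
  then have "sat \<rho> w (Suc d') (v'(d' := a)) (ccov T x (sing d')) = sccov Cv w (v' x) (single a)" for a
    using sat_ccov[OF T, of "Suc d'" "v'(d' := a)" "sing d'" "single a" x w] * by simp
  ultimately show "sat \<rho> w d' v' (down T C C' x) = sdown P Cv K L w (v' x)"
    using * unfolding down_def sdown_def sat_simps by (simp add: sat_pts[OF T] denotes_at)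
qed

lemma denotes_val_at:
  assumes "f < d" "a < d"
  shows "denotes \<rho> d v (val_at f a) (sval (v f) (v a))"
  by (rule denotesI) (use assms in \<open>simp add: val_at_def sval_def sat_simps sat_is_pair\<close>)

lemma denotes_im:
  assumes "f < d" and K: "denotes \<rho> d v C K"
  shows "denotes \<rho> d v (im f C) (sim (v f) K)"
proof (rule denotesI)
  fix w d' v' x assume *: "d \<le> d'" "\<And>i. i < d \<Longrightarrow> v' i = v i" "x < d'"
  have "denotes \<rho> d' v' C K" using * K by (auto intro: denotes_weaken)
  moreover have "sat \<rho> w (Suc d') (v'(d' := a)) (val_at f d' x) = sval (v f) a w (v' x)" for a
    using denotesD[OF denotes_val_at[of f "Suc d'" d' \<rho> "v'(d' := a)"], of x] * assms by simp
  ultimately show "sat \<rho> w d' v' (im f C x) = sim (v f) K w (v' x)"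
    unfolding im_def sim_def sat_simps by (simp add: denotes_at)
qed

lemma denotes_mor_comp:
  assumes "h < d" "p < d" "a < d"
  shows "denotes \<rho> d v (mor_comp h p a) (sim (v h) (sval (v p) (v a)))"
  unfolding mor_comp_def by (intro denotes_im denotes_val_at assms)

lemma sat_mor_eq:
  assumes A: "space_denotes \<rho> A P Cv" and T: "space_denotes \<rho> T Q Cw"
    and F: "\<And>a. denotes \<rho> (Suc d) (v(d := a)) (F d) (K a)"
    and G: "\<And>a. denotes \<rho> (Suc d) (v(d := a)) (G d) (L a)"
  shows "sat \<rho> w d v (mor_eq A T F G) = (\<forall>w'. w \<sqsubseteq> w' \<longrightarrow> (\<forall>a\<in>D w'. P w' a \<longrightarrow>
    scovers Cw w' (K a) (L a) \<and> scovers Cw w' (L a) (K a)))"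
  unfolding mor_eq_def cov_eq_def sat_all_imp sat_conj
  by (simp add: sat_pts[OF A] sat_covers[OF T F G] sat_covers[OF T G F])

lemma sat_imp_imp: "sat \<rho> w d v (P \<^bold>\<longrightarrow> Q \<^bold>\<longrightarrow> R) =
    (\<forall>w'. w \<sqsubseteq> w' \<longrightarrow> sat \<rho> w' d v P \<longrightarrow> sat \<rho> w' d v Q \<longrightarrow> sat \<rho> w' d v R)"
  unfolding sat_imp by (meson le_refl le_trans sat_mono)

lemma sat_all_imp_imp: "sat \<rho> w d v (\<^bold>\<forall>x. P x \<^bold>\<longrightarrow> Q x \<^bold>\<longrightarrow> R x) = (\<forall>w'. w \<sqsubseteq> w' \<longrightarrow> (\<forall>a\<in>D w'.
    sat \<rho> w' (Suc d) (v(d := a)) (P d) \<longrightarrow> sat \<rho> w' (Suc d) (v(d := a)) (Q d) \<longrightarrow>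
    sat \<rho> w' (Suc d) (v(d := a)) (R d)))"
  unfolding sat_all sat_imp_imp by (rule all_worlds_collapse)

lemma all_worlds_collapse2:
  "(\<forall>w'. w \<sqsubseteq> w' \<longrightarrow> (\<forall>a\<in>D w'. \<forall>w''. w' \<sqsubseteq> w'' \<longrightarrow> (\<forall>b\<in>D w''. Q w'' a b))) \<longleftrightarrow>
   (\<forall>w'. w \<sqsubseteq> w' \<longrightarrow> (\<forall>a\<in>D w'. \<forall>b\<in>D w'. Q w' a b))"
  using le_trans D_mono le_refl by metis

lemma sat_all2_imp: "sat \<rho> w d v (\<^bold>\<forall>x. \<^bold>\<forall>y. P x y \<^bold>\<longrightarrow> Q x y) = (\<forall>w'. w \<sqsubseteq> w' \<longrightarrow> (\<forall>a\<in>D w'. \<forall>b\<in>D w'.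
    sat \<rho> w' (Suc (Suc d)) (v(d := a, Suc d := b)) (P d (Suc d)) \<longrightarrow>
    sat \<rho> w' (Suc (Suc d)) (v(d := a, Suc d := b)) (Q d (Suc d))))"
  unfolding sat_all[of _ _ d] sat_all_imp by (rule all_worlds_collapse2)

lemma sat_all2_imp_imp: "sat \<rho> w d v (\<^bold>\<forall>x. \<^bold>\<forall>y. P x y \<^bold>\<longrightarrow> Q x y \<^bold>\<longrightarrow> R x y) =
    (\<forall>w'. w \<sqsubseteq> w' \<longrightarrow> (\<forall>a\<in>D w'. \<forall>b\<in>D w'.
    sat \<rho> w' (Suc (Suc d)) (v(d := a, Suc d := b)) (P d (Suc d)) \<longrightarrow>
    sat \<rho> w' (Suc (Suc d)) (v(d := a, Suc d := b)) (Q d (Suc d)) \<longrightarrow>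
    sat \<rho> w' (Suc (Suc d)) (v(d := a, Suc d := b)) (R d (Suc d))))"
  unfolding sat_all[of _ _ d] sat_all_imp_imp by (rule all_worlds_collapse2)

lemma sat_all3_imp_imp: "sat \<rho> w d v (\<^bold>\<forall>x. \<^bold>\<forall>y. \<^bold>\<forall>z. P x y z \<^bold>\<longrightarrow> Q x y z \<^bold>\<longrightarrow> R x y z) =
    (\<forall>w'. w \<sqsubseteq> w' \<longrightarrow> (\<forall>a\<in>D w'. \<forall>b\<in>D w'. \<forall>c\<in>D w'.
    sat \<rho> w' (Suc (Suc (Suc d))) (v(d := a, Suc d := b, Suc (Suc d) := c)) (P d (Suc d) (Suc (Suc d))) \<longrightarrow>
    sat \<rho> w' (Suc (Suc (Suc d))) (v(d := a, Suc d := b, Suc (Suc d) := c)) (Q d (Suc d) (Suc (Suc d))) \<longrightarrow>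
    sat \<rho> w' (Suc (Suc (Suc d))) (v(d := a, Suc d := b, Suc (Suc d) := c)) (R d (Suc d) (Suc (Suc d)))))"
  unfolding sat_all[of _ _ d] sat_all2_imp_imp
  using all_worlds_collapse2[where Q = "\<lambda>w' a b. \<forall>c\<in>D w'.
    sat \<rho> w' (Suc (Suc (Suc d))) (v(d := a, Suc d := b, Suc (Suc d) := c)) (P d (Suc d) (Suc (Suc d))) \<longrightarrow>
    sat \<rho> w' (Suc (Suc (Suc d))) (v(d := a, Suc d := b, Suc (Suc d) := c)) (Q d (Suc d) (Suc (Suc d))) \<longrightarrow>
    sat \<rho> w' (Suc (Suc (Suc d))) (v(d := a, Suc d := b, Suc (Suc d) := c)) (R d (Suc d) (Suc (Suc d)))"]
  by fast

definition sft :: "('w \<Rightarrow> 'a \<Rightarrow> bool) \<Rightarrow> ('w \<Rightarrow> 'a \<Rightarrow> 'a \<Rightarrow> bool) \<Rightarrow> 'w \<Rightarrow> bool" where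
  "sft P Cv w \<longleftrightarrow>
    (\<exists>s\<in>D w. isset w s P) \<and>
    (\<forall>w'. w \<sqsubseteq> w' \<longrightarrow> (\<forall>a\<in>D w'. \<forall>u\<in>D w'. P w' a \<and> subcl w' (elem u) P \<longrightarrow> M w' a u \<longrightarrow> Cv w' a u)) \<and>
    (\<forall>w'. w \<sqsubseteq> w' \<longrightarrow> (\<forall>a\<in>D w'. \<forall>u\<in>D w'. \<forall>z\<in>D w'.
      P w' a \<and> subcl w' (elem u) P \<and> subcl w' (elem z) P \<longrightarrow>
      Cv w' a u \<and> (\<forall>w''. w' \<sqsubseteq> w'' \<longrightarrow> (\<forall>b\<in>D w''. M w'' b u \<longrightarrow> Cv w'' b z)) \<longrightarrow> Cv w' a z)) \<and>
    (\<forall>w'. w \<sqsubseteq> w' \<longrightarrow> (\<forall>a\<in>D w'. \<forall>u\<in>D w'. \<forall>z\<in>D w'.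
      P w' a \<and> subcl w' (elem u) P \<and> subcl w' (elem z) P \<longrightarrow>
      Cv w' a u \<and> Cv w' a z \<longrightarrow> sccov Cv w' a (sdown P Cv (elem u) (elem z)))) \<and>
    (\<forall>w'. w \<sqsubseteq> w' \<longrightarrow> (\<forall>u\<in>D w'. subcl w' (elem u) P \<longrightarrow>
      (\<exists>z\<in>D w'. isset w' z (\<lambda>w a. P w a \<and> Cv w a u))))"

definition smor :: "('w \<Rightarrow> 'a \<Rightarrow> bool) \<Rightarrow> ('w \<Rightarrow> 'a \<Rightarrow> 'a \<Rightarrow> bool) \<Rightarrow>
    ('w \<Rightarrow> 'a \<Rightarrow> bool) \<Rightarrow> ('w \<Rightarrow> 'a \<Rightarrow> 'a \<Rightarrow> bool) \<Rightarrow> 'w \<Rightarrow> 'a \<Rightarrow> bool" where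
  "smor P C Q Cq w f \<longleftrightarrow>
    ((\<forall>w'. w \<sqsubseteq> w' \<longrightarrow> (\<forall>p\<in>D w'. M w' p f \<longrightarrow>
        (\<exists>a\<in>D w'. \<exists>y\<in>D w'. P w' a \<and> subcl w' (elem y) Q \<and> pair w' p a y))) \<and>
     (\<forall>w'. w \<sqsubseteq> w' \<longrightarrow> (\<forall>a\<in>D w'. P w' a \<longrightarrow>
        (\<exists>y\<in>D w'. (\<exists>p\<in>D w'. M w' p f \<and> pair w' p a y) \<and>
          (\<forall>w''. w' \<sqsubseteq> w'' \<longrightarrow> (\<forall>y'\<in>D w''. (\<exists>p\<in>D w''. M w'' p f \<and> pair w'' p a y') \<longrightarrow> E w'' y' y)))))) \<and>
    (scovers Cq w (sim f P) Q \<and> scovers Cq w Q (sim f P)) \<and>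
    (\<forall>w'. w \<sqsubseteq> w' \<longrightarrow> (\<forall>a\<in>D w'. \<forall>b\<in>D w'. P w' a \<and> P w' b \<longrightarrow>
      scovers Cq w' (sdown Q Cq (sval f a) (sval f b)) (sim f (sdown P C (single a) (single b))))) \<and>
    (\<forall>w'. w \<sqsubseteq> w' \<longrightarrow> (\<forall>a\<in>D w'. \<forall>u\<in>D w'. P w' a \<and> subcl w' (elem u) P \<longrightarrow> C w' a u \<longrightarrow>
      scovers Cq w' (sval f a) (sim f (elem u))))"

lemma sat_el_subset_pts: "space_denotes \<rho> T P Cv \<Longrightarrow> u < d \<Longrightarrow>
    sat \<rho> w d v (el u \<^bold>\<subseteq> pts T) = subcl w (elem (v u)) P"
  by (intro sat_subcls denotes_el denotes_pts)

lemma sat_formal_topology: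
  assumes T: "space_denotes \<rho> T P Cv"
  shows "sat \<rho> w d v (formal_topology T) = sft P Cv w"
proof -
  have dn: "u < d \<Longrightarrow> z < d \<Longrightarrow> denotes \<rho> d v (down T (el u) (el z)) (sdown P Cv (elem (v u)) (elem (v z)))"
    for u z d v by (intro denotes_down T denotes_el)
  have cl: "u < d \<Longrightarrow> denotes \<rho> d v (\<lambda>a. pts T a \<^bold>\<and> cov T a u) (\<lambda>w a. P w a \<and> Cv w a (v u))" for u d v
    by (rule denotesI) (simp add: sat_conj sat_pts[OF T] sat_cov[OF T])
  show ?thesis
    unfolding formal_topology_def sft_def sat_conj sat_all2_imp_imp sat_all3_imp_imp sat_all_imp sat_ex
    by (simp add: sat_pts[OF T] sat_cov[OF T] sat_mem sat_el_subset_pts[OF T]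
      sat_is_set_of[OF denotes_pts[OF T]] sat_ccov[OF T dn] sat_is_set_of[OF cl])
qed

lemma sat_morphism:
  assumes A: "space_denotes \<rho> A P C" and B: "space_denotes \<rho> B Q Cq" and f: "f < d"
  shows "sat \<rho> w d v (morphism A B f) = smor P C Q Cq w (v f)"
proof -
  have im: "denotes \<rho> d v (im f (pts A)) (sim (v f) P)"
    using f by (intro denotes_im denotes_pts[OF A])
  have dn: "f < d \<Longrightarrow> a < d \<Longrightarrow> b < d \<Longrightarrow>
      denotes \<rho> d v (down B (val_at f a) (val_at f b)) (sdown Q Cq (sval (v f) (v a)) (sval (v f) (v b)))"
    for a b d v by (intro denotes_down B denotes_val_at)
  have dn': "f < d \<Longrightarrow> a < d \<Longrightarrow> b < d \<Longrightarrow>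
      denotes \<rho> d v (im f (down A (sing a) (sing b))) (sim (v f) (sdown P C (single (v a)) (single (v b))))"
    for a b d v by (intro denotes_im denotes_down A denotes_sing)
  have imu: "f < d \<Longrightarrow> u < d \<Longrightarrow> denotes \<rho> d v (im f (el u)) (sim (v f) (elem (v u)))" for u d v
    by (intro denotes_im denotes_el)
  show ?thesis
    using f unfolding morphism_def is_map_def cov_eq_def smor_def sat_conj sat_all2_imp_imp sat_all2_imp
      sat_all_imp sat_ex1 sat_ex
    by (simp add: sat_pts[OF A] sat_cov[OF A] sat_mem sat_el_subset_pts[OF A] sat_el_subset_pts[OF B]
      sat_is_pair sat_covers[OF B im denotes_pts[OF B]] sat_covers[OF B denotes_pts[OF B] im]
      sat_covers[OF B dn dn'] sat_covers[OF B denotes_val_at imu])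
qed

lemma sft_mono:
  assumes "space_denotes \<rho> T P Cv" "w \<sqsubseteq> w'" "sft P Cv w"
  shows "sft P Cv w'"
  using sat_mono[OF assms(2), of \<rho> 0 _ "formal_topology T"] assms
  by (simp add: sat_formal_topology[OF assms(1)])

lemma smor_mono:
  assumes "space_denotes \<rho> A P C" "space_denotes \<rho> B Q Cq" "w \<sqsubseteq> w'" "smor P C Q Cq w f"
  shows "smor P C Q Cq w' f"
  using sat_mono[OF assms(3), of \<rho> 1 "\<lambda>_. f" "morphism A B 0"] assms(4)
  by (simp add: sat_morphism[OF assms(1,2)])

section \<open>Persistence and invariance under equality\<close>

lemma isset_mono: "isset w z K \<Longrightarrow> w \<sqsubseteq> w' \<Longrightarrow> isset w' z K"
  unfolding isset_def using le_trans by blast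

lemma subcl_mono: "subcl w K L \<Longrightarrow> w \<sqsubseteq> w' \<Longrightarrow> subcl w' K L"
  unfolding subcl_def using le_trans by blast

lemma isset_iff: "isset w z K \<Longrightarrow> w \<sqsubseteq> w' \<Longrightarrow> x \<in> D w' \<Longrightarrow> M w' x z = K w' x"
  unfolding isset_def by blast

lemma isset_E_cong: "E w z z' \<Longrightarrow> isset w z K \<Longrightarrow> isset w z' K"
  unfolding isset_def by (metis E_mono E_refl E_sym M_cong)

lemma isset_cong:
  "(\<And>w' x. w \<sqsubseteq> w' \<Longrightarrow> x \<in> D w' \<Longrightarrow> K w' x = L w' x) \<Longrightarrow> isset w z K = isset w z L"
  unfolding isset_def by auto

lemma isset_transfer:
  "isset w z K \<Longrightarrow> (\<And>w' x. w \<sqsubseteq> w' \<Longrightarrow> x \<in> D w' \<Longrightarrow> K w' x = L w' x) \<Longrightarrow> isset w z L"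
  using isset_cong by blast

lemma pair_mono: "pair w p a b \<Longrightarrow> w \<sqsubseteq> w' \<Longrightarrow> pair w' p a b"
  unfolding pair_def by (rule isset_mono)

lemma pair_E_cong:
  assumes "E w p p'" "E w a a'" "E w b b'" "pair w p a b"
  shows "pair w p' a' b'"
proof -
  have "sat (\<lambda>_. p) w 3 (case_nat p (case_nat a (\<lambda>_. b))) (is_pair 0 1 2)"
    using assms by (simp add: sat_is_pair numeral_2_eq_2)
  then have "sat (\<lambda>_. p) w 3 (case_nat p' (case_nat a' (\<lambda>_. b'))) (is_pair 0 1 2)"
    by (rule sat_E_cong[rotated]) (use assms in \<open>auto split: nat.split\<close>)
  then show ?thesis by (simp add: sat_is_pair numeral_2_eq_2)
qed

lemma zero_mono: "zero w x \<Longrightarrow> w \<sqsubseteq> w' \<Longrightarrow> zero w' x"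
  unfolding zero_def by (rule isset_mono)

lemma one_mono: "one w x \<Longrightarrow> w \<sqsubseteq> w' \<Longrightarrow> one w' x"
  unfolding one_def by (rule isset_mono)

lemma zero_E_cong: "E w x y \<Longrightarrow> zero w x \<Longrightarrow> zero w y"
  unfolding zero_def by (rule isset_E_cong)

lemma one_E_cong: "E w x y \<Longrightarrow> one w x \<Longrightarrow> one w y"
  unfolding one_def by (rule isset_E_cong)

lemma sval_cong: "E w a a' \<Longrightarrow> sval f a w x \<Longrightarrow> sval f a' w x"
  unfolding sval_def using pair_E_cong E_refl by meson

lemma sat_0: "sat \<rho> w 0 v F = sem w \<rho> (F 0)"
  by (simp add: sat_def)

lemma sem_sat1: "sem w (case_nat x \<rho>) (F (Suc 0)) = sat \<rho> w (Suc 0) (\<lambda>_. x) F"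
  unfolding sat_def by (rule sem_cong) (auto split: nat.split)

text \<open>Index 0 belongs to the innermost binder, which has level 1 at depth 2, so the two values
  appear in reverse order.\<close>

lemma sem_sat2: "sem w (case_nat x (case_nat y \<rho>)) (F (Suc (Suc 0))) =
    sat \<rho> w (Suc (Suc 0)) (case_nat y (\<lambda>_. x)) F"
  unfolding sat_def by (rule sem_cong) (auto split: nat.split)

lemma sat_sch1: "x < d \<Longrightarrow> sat \<rho> w d v (sch p [x]) = sem w (case_nat (v x) \<rho>) p"
  by (subst sat_sch) (auto intro!: sem_cong split: nat.split)

lemma sat_sch2: "x < d \<Longrightarrow> y < d \<Longrightarrow> sat \<rho> w d v (sch p [x, y]) = sem w (case_nat (v x) (case_nat (v y) \<rho>)) p"
  by (subst sat_sch) (auto intro!: sem_cong simp: nth_Cons' split: nat.split)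

end

subsection \<open>Consequences of the axioms\<close>

locale czf_model = kripke_model le D M E CZF_axioms
  for le :: "'w \<Rightarrow> 'w \<Rightarrow> bool" (infix "\<sqsubseteq>" 50) and D :: "'w \<Rightarrow> 'a set" and M E
begin

lemma sat_axiom: "F 0 \<in> CZF_axioms \<Longrightarrow> (\<And>i. \<rho> i \<in> D w) \<Longrightarrow> sat \<rho> w 0 v F"
  unfolding sat_0 by (rule sem_Ax)

lemma sat_closed_axiom: "F 0 \<in> CZF_axioms \<Longrightarrow> \<exists>\<rho>. sat \<rho> w 0 v F"
  using sat_axiom[of F "\<lambda>_. SOME x. x \<in> D w"] D_nonempty[of w] by (metis someI_ex all_not_in_conv)

lemma extensionality:
  assumes "a \<in> D w" "b \<in> D w" "isset w a (elem b)"
  shows "E w a b"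
proof -
  obtain \<rho> where "sat \<rho> w 0 (\<lambda>_. a) ax_extensionality"
    using sat_closed_axiom[of ax_extensionality] by (auto simp: CZF_axioms_def)
  then show ?thesis
    unfolding ax_extensionality_def sat_all2_imp
    using assms by (auto simp: sat_is_set_of[OF denotes_el] sat_eq)
qed

lemma isset_unique:
  assumes "isset w z K" "isset w y K" "z \<in> D w" "y \<in> D w"
  shows "E w z y"
  using assms by (intro extensionality) (auto simp: isset_def elem_def)

lemma ex_duo:
  assumes "a \<in> D w" "b \<in> D w"
  shows "\<exists>c\<in>D w. isset w c (duo a b)"
proof -
  obtain \<rho> where "sat \<rho> w 0 (\<lambda>_. a) ax_pairing"
    using sat_closed_axiom[of ax_pairing] by (auto simp: CZF_axioms_def)
  then have "\<forall>w'. w \<sqsubseteq> w' \<longrightarrow> (\<forall>a\<in>D w'. \<forall>w''. w' \<sqsubseteq> w'' \<longrightarrow> (\<forall>b\<in>D w''. \<exists>c\<in>D w''. isset w'' c (duo a b)))"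
    unfolding ax_pairing_def sat_all sat_ex by (simp add: sat_is_set_of[OF denotes_upair])
  then show ?thesis using assms by blast
qed

lemma ex_single: "a \<in> D w \<Longrightarrow> \<exists>c\<in>D w. isset w c (single a)"
  using ex_duo[of a w a] by (simp add: duo_def single_def)

text \<open>The empty set comes from the axiom of infinity: an inductive set has an empty
  element.\<close>

lemma ex_zero: "\<exists>z\<in>D w. zero w z"
proof -
  obtain \<rho> where "sat \<rho> w 0 undefined ax_infinity"
    using sat_closed_axiom[of ax_infinity] by (auto simp: CZF_axioms_def)
  then show ?thesis
    unfolding ax_infinity_def is_inductive_def sat_ex sat_conj
    by (auto simp: denotes_at[OF denotes_is_zero])
qed

lemma ex_separation:
  assumes "bounded p" "\<And>i. \<rho> i \<in> D w" "a \<in> D w"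
  shows "\<exists>b\<in>D w. isset w b (\<lambda>w x. M w x a \<and> sem w (case_nat x \<rho>) p)"
proof -
  have "denotes \<rho> (Suc (Suc 0)) v (\<lambda>x. x \<^bold>\<in> 0 \<^bold>\<and> sch p [x]) (\<lambda>w x. M w x (v 0) \<and> sem w (case_nat x \<rho>) p)" for v
    by (rule denotesI) (simp add: sat_conj sat_mem sat_sch1)
  note set = sat_is_set_of[OF this]
  have "sat \<rho> w 0 (\<lambda>_. a) (ax_separation p)"
    using assms by (intro sat_axiom) (auto simp: CZF_axioms_def)
  then have "\<forall>w'. w \<sqsubseteq> w' \<longrightarrow> (\<forall>a\<in>D w'. \<exists>b\<in>D w'. isset w' b (\<lambda>w x. M w x a \<and> sem w (case_nat x \<rho>) p))"
    unfolding ax_separation_def sat_all sat_ex by (simp add: set)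
  then show ?thesis using assms(3) by blast
qed

lemma strong_collection:
  assumes "\<And>i. \<rho> i \<in> D w" "a \<in> D w"
    and "\<And>w' x. w \<sqsubseteq> w' \<Longrightarrow> M w' x a \<Longrightarrow> \<exists>y\<in>D w'. sem w' (case_nat x (case_nat y \<rho>)) p"
  shows "\<exists>b\<in>D w.
    (\<forall>w'. w \<sqsubseteq> w' \<longrightarrow> (\<forall>x\<in>D w'. M w' x a \<longrightarrow> (\<exists>y\<in>D w'. M w' y b \<and> sem w' (case_nat x (case_nat y \<rho>)) p))) \<and>
    (\<forall>w'. w \<sqsubseteq> w' \<longrightarrow> (\<forall>y\<in>D w'. M w' y b \<longrightarrow> (\<exists>x\<in>D w'. M w' x a \<and> sem w' (case_nat x (case_nat y \<rho>)) p)))"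
proof -
  have "sat \<rho> w 0 (\<lambda>_. a) (ax_strong_collection p)"
    using assms(1) by (intro sat_axiom) (auto simp: CZF_axioms_def)
  then have "(\<forall>w'. w \<sqsubseteq> w' \<longrightarrow> (\<forall>x\<in>D w'. M w' x a \<longrightarrow> (\<exists>y\<in>D w'. sem w' (case_nat x (case_nat y \<rho>)) p))) \<longrightarrow> ?thesis"
    unfolding ax_strong_collection_def sat_all_imp sat_ex sat_conj
    using assms(2) by (auto simp: sat_sch2 sat_mem)
  then show ?thesis using assms(3) by blast
qed

lemma ex_pair:
  assumes "a \<in> D w" "b \<in> D w"
  shows "\<exists>p\<in>D w. pair w p a b"
proof -
  obtain s t where st: "s \<in> D w" "isset w s (single a)" "t \<in> D w" "isset w t (duo a b)"
    using ex_single[OF assms(1)] ex_duo[OF assms] by blast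
  obtain p where p: "p \<in> D w" "isset w p (duo s t)" using ex_duo[OF st(1,3)] by blast
  have "E w' z s = isset w' z (single a)" "E w' z t = isset w' z (duo a b)" if "w \<sqsubseteq> w'" "z \<in> D w'" for w' z
    using that st by (meson D_mono E_sym isset_E_cong isset_mono isset_unique)+
  then have "pair w p a b" using p unfolding pair_def by (simp add: isset_def duo_def)
  then show ?thesis using p by blast
qed

lemma pair_unique: "pair w p a b \<Longrightarrow> pair w q a b \<Longrightarrow> p \<in> D w \<Longrightarrow> q \<in> D w \<Longrightarrow> E w p q"
  unfolding pair_def by (rule isset_unique)

text \<open>Kuratowski's argument with \<open>s\<close>, \<open>t\<close>, \<open>t'\<close> for
  {a}, {a,b}, {a',b'}. Whichever way {a} occurs in the second description of \<open>p\<close>, it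
  contains a'. If {a,b} equals {a'}, then b equals a', and b' is read off from the occurrence of
  {a',b'} in the first description.\<close>

lemma pair_inj:
  assumes p: "pair w p a b" "pair w p a' b'" and D: "a \<in> D w" "b \<in> D w" "a' \<in> D w" "b' \<in> D w"
  shows "E w a a' \<and> E w b b'"
proof -
  have mem: "M w z p = (isset w z (single a) \<or> isset w z (duo a b))"
    "M w z p = (isset w z (single a') \<or> isset w z (duo a' b'))" if "z \<in> D w" for z
    using isset_iff[OF p(1)[unfolded pair_def] le_refl that]
      isset_iff[OF p(2)[unfolded pair_def] le_refl that] by simp_all
  have S: "M w x z = E w x c" if "isset w z (single c)" "x \<in> D w" for x z c
    using that by (auto simp: isset_iff[OF _ le_refl] single_def)
  have T: "M w x z = (E w x c \<or> E w x d)" if "isset w z (duo c d)" "x \<in> D w" for x z c d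
    using that by (auto simp: isset_iff[OF _ le_refl] duo_def)
  obtain s t t' where st: "s \<in> D w" "isset w s (single a)" "t \<in> D w" "isset w t (duo a b)"
    "t' \<in> D w" "isset w t' (duo a' b')"
    using ex_single ex_duo D by meson
  have aa': "E w a' a"
    using mem[OF st(1)] st(2) S T D by (metis E_refl)
  have "isset w t (single a') \<or> isset w t (duo a' b')" using mem[OF st(3)] st(4) by blast
  then have "E w b b'"
  proof
    assume "isset w t (duo a' b')"
    then show "E w b b'" using T[OF st(4)] T[of t a' b'] aa' D by (metis E_refl E_sym E_trans)
  next
    assume t: "isset w t (single a')"
    have b: "E w b a'" using T[OF st(4)] S[OF t] D by (metis E_refl)
    have "isset w t' (single a) \<or> isset w t' (duo a b)" using mem[OF st(5)] st(6) by blast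
    then have "E w b' a \<or> E w b' b"
      using T[OF st(6)] S[of t' a b'] T[of t' a b b'] D by blast
    then show "E w b b'" using aa' b by (metis E_sym E_trans)
  qed
  then show ?thesis using aa' E_sym by blast
qed

end

section \<open>Spaces whose covering is a double negation\<close>

text \<open>
  In a space as below every point is either covered by the empty set (class \<open>R\<close>) or equal to a top
  element (class \<open>U\<close>), and the top element is covered by \<open>u\<close> iff it is not not in \<open>u\<close>.
\<close>

locale notnot_space = czf_model le D M E
  for le :: "'w \<Rightarrow> 'w \<Rightarrow> bool" (infix "\<sqsubseteq>" 50) and D :: "'w \<Rightarrow> 'a set" and M E +
  fixes P :: "'w \<Rightarrow> 'a \<Rightarrow> bool" and C :: "'w \<Rightarrow> 'a \<Rightarrow> 'a \<Rightarrow> bool" and R U :: "'w \<Rightarrow> 'a \<Rightarrow> bool"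
    and A :: space
  assumes A: "space_denotes \<rho> A P C"
    and P_iff: "x \<in> D w \<Longrightarrow> P w x \<longleftrightarrow> R w x \<or> U w x"
    and RU: "x \<in> D w \<Longrightarrow> R w x \<Longrightarrow> U w x \<Longrightarrow> False"
    and U_unique: "x \<in> D w \<Longrightarrow> y \<in> D w \<Longrightarrow> U w x \<Longrightarrow> U w y \<Longrightarrow> E w x y"
    and R_mono: "w \<sqsubseteq> w' \<Longrightarrow> R w x \<Longrightarrow> R w' x"
    and R_cong: "E w x y \<Longrightarrow> R w x \<Longrightarrow> R w y"
    and U_mono: "w \<sqsubseteq> w' \<Longrightarrow> U w x \<Longrightarrow> U w' x"
    and R_set: "\<exists>r\<in>D w. isset w r R"
    and P_set: "\<exists>s\<in>D w. isset w s P"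
    and C_iff: "a \<in> D w \<Longrightarrow> u \<in> D w \<Longrightarrow> P w a \<Longrightarrow> subcl w (elem u) P \<Longrightarrow>
      C w a u \<longleftrightarrow> R w a \<or> (\<forall>w'. w \<sqsubseteq> w' \<longrightarrow> (\<exists>w''. w' \<sqsubseteq> w'' \<and> M w'' a u))"
begin

lemma P_mono: "w \<sqsubseteq> w' \<Longrightarrow> P w a \<Longrightarrow> P w' a"
  by (rule space_pts_mono[OF A])

lemma P_cong: "E w a b \<Longrightarrow> P w a \<Longrightarrow> P w b"
  by (rule space_pts_cong[OF A])

lemma subcl_single: "P w a \<Longrightarrow> isset w z (single a) \<Longrightarrow> subcl w (elem z) P"
  unfolding subcl_def elem_def by (metis P_cong P_mono E_sym isset_iff single_def)

lemma subcl_P: "subcl w (elem u) P \<Longrightarrow> w \<sqsubseteq> w' \<Longrightarrow> M w' x u \<Longrightarrow> P w' x"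
  unfolding subcl_def elem_def using M_D by blast

lemma cover_mem: "P w a \<Longrightarrow> subcl w (elem u) P \<Longrightarrow> M w a u \<Longrightarrow> C w a u"
  using C_iff[of a w u] M_D M_mono by blast

text \<open>Double negations compose: beyond every world there is one with \<open>a\<close> in
  \<open>u\<close>, there \<open>z\<close> covers \<open>a\<close>, and so a still later world has
  \<open>a\<close> in \<open>z\<close>.\<close>

lemma cover_trans:
  assumes "a \<in> D w" "u \<in> D w" "z \<in> D w" "P w a" "subcl w (elem u) P" "subcl w (elem z) P" "C w a u"
    and *: "\<And>w' b. w \<sqsubseteq> w' \<Longrightarrow> b \<in> D w' \<Longrightarrow> M w' b u \<Longrightarrow> C w' b z"
  shows "C w a z"
proof (cases "R w a")
  case True
  then show ?thesis using assms C_iff[of a w z] by blast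
next
  case False
  then have U: "U w a" using P_iff assms by blast
  have nn: "\<exists>w''. w' \<sqsubseteq> w'' \<and> M w'' a u" if "w \<sqsubseteq> w'" for w'
    using C_iff[of a w u] assms False that by blast
  have "\<exists>w''. w' \<sqsubseteq> w'' \<and> M w'' a z" if w': "w \<sqsubseteq> w'" for w'
  proof -
    obtain w1 where w1: "w' \<sqsubseteq> w1" "M w1 a u" using nn w' by blast
    then have le: "w \<sqsubseteq> w1" using w' le_trans by blast
    have "C w1 a z" using * le w1 M_D by blast
    moreover have "\<not> R w1 a" using RU U_mono U le M_D w1 by blast
    moreover have "a \<in> D w1" "z \<in> D w1" "P w1 a" "subcl w1 (elem z) P"
      using assms le D_mono P_mono subcl_mono by blast+
    ultimately show ?thesis using C_iff[of a w1 z] w1 le_trans le_refl by blast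
  qed
  then show ?thesis using assms C_iff[of a w z] by blast
qed

text \<open>Off \<open>R\<close> the covering yields equality only at a later world. This already
  excludes \<open>u\<close> from \<open>R\<close>, since otherwise \<open>x\<close> would enter
  \<open>R\<close> there. So both points lie in \<open>U\<close>, which has at most one element, and
  equality holds now.\<close>

lemma sccov_single:
  assumes "x \<in> D w" "u \<in> D w" "P w x" "P w u"
  shows "sccov C w x (single u) \<longleftrightarrow> R w x \<or> E w x u"
proof
  assume "sccov C w x (single u)"
  then obtain z where z: "z \<in> D w" "isset w z (single u)" "C w x z" by (auto simp: sccov_def)
  show "R w x \<or> E w x u"
  proof (cases "R w x")
    case False
    then have x: "U w x" using P_iff assms by blast
    obtain w' where w': "w \<sqsubseteq> w'" "M w' x z"
      using C_iff[of x w z] z subcl_single assms False le_refl by blast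
    then have "E w' x u" using z(2) isset_iff M_D by (metis single_def)
    moreover have "\<not> R w' x" using RU U_mono x w' M_D by blast
    ultimately have "\<not> R w u" using R_mono R_cong E_sym w' by blast
    then show ?thesis using x P_iff U_unique assms by blast
  qed blast
next
  assume *: "R w x \<or> E w x u"
  obtain z where z: "z \<in> D w" "isset w z (single u)" using ex_single assms by blast
  have "C w x z"
    using * C_iff[of x w z] z assms subcl_single cover_mem[of w x z] isset_iff[OF z(2) le_refl, of x]
    by (auto simp: single_def)
  then show "sccov C w x (single u)" using z by (auto simp: sccov_def)
qed

lemma sdown_set:
  assumes u: "u \<in> D w" "subcl w (elem u) P" and z: "z \<in> D w" "subcl w (elem z) P"
  shows "\<exists>b\<in>D w. isset w b (sdown P C (elem u) (elem z))"
proof -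
  obtain r s where r: "r \<in> D w" "isset w r R" and s: "s \<in> D w" "isset w s P"
    using R_set P_set by blast
  \<comment> \<open>By \<open>sccov_single\<close> the covering inside \<open>sdown\<close> can be
    replaced by a bounded condition. Index 0 is the point and 1, 2, 3 are \<open>r\<close>,
    \<open>u\<close>, \<open>z\<close>; below the quantifiers every index grows by one.\<close>
  define p where "p = Conj
    (Exists (Conj (Mem 0 (Suc (Suc (Suc 0)))) (Disj (Mem 1 2) (Eq 1 0))))
    (Exists (Conj (Mem 0 (Suc (Suc (Suc (Suc 0))))) (Disj (Mem 1 2) (Eq 1 0))))"
  have bd: "bounded p" unfolding p_def by (intro bounded.intros)
  have env: "case_nat r (case_nat u (\<lambda>_. z)) i \<in> D w" for i
    using r u z by (auto split: nat.split)
  obtain b where b: "b \<in> D w"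
    "isset w b (\<lambda>w x. M w x s \<and> sem w (case_nat x (case_nat r (case_nat u (\<lambda>_. z)))) p)"
    using ex_separation[where \<rho> = "case_nat r (case_nat u (\<lambda>_. z))", OF bd env s(1)] by blast
  have "(M w' x s \<and> sem w' (case_nat x (case_nat r (case_nat u (\<lambda>_. z)))) p) =
    sdown P C (elem u) (elem z) w' x" if w': "w \<sqsubseteq> w'" "x \<in> D w'" for w' x
  proof -
    have "M w' x s = P w' x" "M w' x r = R w' x"
      using isset_iff[OF s(2) w'] isset_iff[OF r(2) w'] by blast+
    moreover have "(\<exists>y\<in>D w'. M w' y t \<and> sccov C w' x (single y)) \<longleftrightarrow>
        (\<exists>y\<in>D w'. M w' y t \<and> (R w' x \<or> E w' x y))" if "P w' x" "t = u \<or> t = z" for t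
    proof (intro bex_cong refl conj_cong)
      show "sccov C w' x (single y) = (R w' x \<or> E w' x y)" if "y \<in> D w'" "M w' y t" for y
        using that \<open>P w' x\<close> \<open>t = u \<or> t = z\<close> subcl_P u z w' by (intro sccov_single) blast+
    qed
    ultimately show ?thesis
      unfolding p_def sdown_def elem_def by (simp add: numeral_2_eq_2 cong: conj_cong)
  qed
  then have "isset w b (sdown P C (elem u) (elem z))" by (rule isset_transfer[OF b(2)])
  then show ?thesis using b by blast
qed

lemma sft: "sft P C w"
  unfolding sft_def
proof (intro conjI allI impI ballI)
  show "\<exists>s\<in>D w. isset w s P" by (rule P_set)
next
  fix w' a u
  assume "P w' a \<and> subcl w' (elem u) P" "M w' a u"
  then show "C w' a u" using cover_mem by blast
next
  fix w' a u z
  assume "a \<in> D w'" "u \<in> D w'" "z \<in> D w'" "P w' a \<and> subcl w' (elem u) P \<and> subcl w' (elem z) P"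
    "C w' a u \<and> (\<forall>w''. w' \<sqsubseteq> w'' \<longrightarrow> (\<forall>b\<in>D w''. M w'' b u \<longrightarrow> C w'' b z))"
  then show "C w' a z" using cover_trans[of a w' u z] by blast
next
  fix w' a u z
  assume D: "a \<in> D w'" "u \<in> D w'" "z \<in> D w'" and sub: "P w' a \<and> subcl w' (elem u) P \<and> subcl w' (elem z) P"
    and c: "C w' a u \<and> C w' a z"
  obtain b where b: "b \<in> D w'" "isset w' b (sdown P C (elem u) (elem z))"
    using sdown_set D sub by blast
  have subb: "subcl w' (elem b) P"
    unfolding subcl_def elem_def using b(2) isset_iff by (metis sdown_def)
  have "C w' a b"
  proof (cases "R w' a")
    case True
    then show ?thesis using C_iff b subb D sub by blast
  next
    case False
    \<comment> \<open>Not not commutes with conjunction: a world with \<open>a\<close> in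
      \<open>u\<close> is extended to one with \<open>a\<close> in both \<open>u\<close> and
      \<open>z\<close>, where \<open>a\<close> belongs to \<open>b\<close>.\<close>
    have "\<exists>w2. w1 \<sqsubseteq> w2 \<and> M w2 a b" if w1: "w' \<sqsubseteq> w1" for w1
    proof -
      obtain w2 where w2: "w1 \<sqsubseteq> w2" "M w2 a u"
        using C_iff[of a w' u] D sub c False w1 by blast
      then have "w' \<sqsubseteq> w2" using w1 le_trans by blast
      then obtain w3 where w3: "w2 \<sqsubseteq> w3" "M w3 a z"
        using C_iff[of a w' z] D sub c False by blast
      have le: "w' \<sqsubseteq> w3" "w1 \<sqsubseteq> w3" using w1 w2 w3 le_trans by blast+
      have a: "a \<in> D w3" "P w3 a" using D D_mono P_mono sub le by blast+
      then have "sccov C w3 a (single a)" using sccov_single by blast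
      moreover have "M w3 a u" using w2 w3 M_mono by blast
      ultimately have "sdown P C (elem u) (elem z) w3 a"
        using w3 a unfolding sdown_def elem_def by blast
      then show ?thesis using isset_iff[OF b(2) le(1) a(1)] le by blast
    qed
    then show ?thesis using C_iff[of a w' b] b subb D sub by blast
  qed
  then show "sccov C w' a (sdown P C (elem u) (elem z))" using b by (auto simp: sccov_def)
next
  fix w' u
  assume u: "u \<in> D w'" "subcl w' (elem u) P"
  obtain r s where r: "r \<in> D w'" "isset w' r R" and s: "s \<in> D w'" "isset w' s P"
    using R_set P_set by blast
  \<comment> \<open>This is \<open>C_iff\<close> as a bounded formula: index 0 is the point, 1 the
    set of \<open>R\<close>-points, 2 the set \<open>u\<close>.\<close>
  define p where "p = Disj (Mem 0 1) (Imp (Imp (Mem 0 2) Bot) Bot)"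
  have bd: "bounded p" unfolding p_def by (intro bounded.intros)
  have env: "case_nat r (\<lambda>_. u) i \<in> D w'" for i
    using r u by (auto split: nat.split)
  obtain b where b: "b \<in> D w'"
    "isset w' b (\<lambda>w x. M w x s \<and> sem w (case_nat x (case_nat r (\<lambda>_. u))) p)"
    using ex_separation[where \<rho> = "case_nat r (\<lambda>_. u)", OF bd env s(1)] by blast
  have "(M w2 x s \<and> sem w2 (case_nat x (case_nat r (\<lambda>_. u))) p) = (P w2 x \<and> C w2 x u)"
    if w2: "w' \<sqsubseteq> w2" "x \<in> D w2" for w2 x
  proof -
    have "M w2 x s = P w2 x" "M w2 x r = R w2 x"
      using isset_iff[OF s(2) w2] isset_iff[OF r(2) w2] by blast+
    moreover have "P w2 x \<Longrightarrow> C w2 x u \<longleftrightarrow> R w2 x \<or> (\<forall>w'. w2 \<sqsubseteq> w' \<longrightarrow> (\<exists>w''. w' \<sqsubseteq> w'' \<and> M w'' x u))"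
      using C_iff[of x w2 u] w2 u subcl_mono D_mono by blast
    ultimately show ?thesis
      by (auto simp: p_def numeral_2_eq_2)
  qed
  then have "isset w' b (\<lambda>w a. P w a \<and> C w a u)" by (rule isset_transfer[OF b(2)])
  then show "\<exists>z\<in>D w'. isset w' z (\<lambda>w a. P w a \<and> C w a u)" using b by blast
qed

section \<open>The identity morphism\<close>

definition graph_id :: "'w \<Rightarrow> 'a \<Rightarrow> bool" where
  "graph_id w q \<longleftrightarrow> (\<exists>a\<in>D w. \<exists>y\<in>D w. P w a \<and> isset w y (single a) \<and> pair w q a y)"

text \<open>Strong collection acts as replacement for a \<mapsto> (a, {a}) on the set of points. Its
  second half keeps foreign elements out of \<open>b\<close>; uniqueness of {a} and of the pair up
  to \<open>E\<close> puts all wanted pairs in.\<close>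

lemma ex_graph_id: "\<exists>f\<in>D w. isset w f graph_id"
proof -
  \<comment> \<open>At depth 2 the argument \<open>x\<close> of the relation has level 1 and its
    value \<open>y\<close> level 0, as in \<open>sem_sat2\<close>.\<close>
  define F :: form where "F = (\<^bold>\<exists>z. z \<^bold>\<equiv> sing 1 \<^bold>\<and> is_pair 0 1 z)"
  define idpair where "idpair w x y \<longleftrightarrow> (\<exists>z\<in>D w. isset w z (single x) \<and> pair w y x z)" for w x y
  have F: "sem w (case_nat x (case_nat y \<rho>)) (F (Suc (Suc 0))) = idpair w x y" for \<rho> w x y
    unfolding sem_sat2 F_def sat_ex sat_conj idpair_def
    by (simp add: sat_is_set_of[OF denotes_sing] sat_is_pair)
  obtain s where s: "s \<in> D w" "isset w s P" using P_set by blast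
  have "\<exists>y\<in>D w'. idpair w' x y" if "M w' x s" for w' x
    using ex_single[OF M_D(1)[OF that]] ex_pair[OF M_D(1)[OF that]] unfolding idpair_def by blast
  from strong_collection[where \<rho> = "\<lambda>_. s" and w = w and a = s and p = "F (Suc (Suc 0))",
      unfolded F, OF s(1) s(1) this]
  obtain b where b: "b \<in> D w"
    "\<And>w' x. w \<sqsubseteq> w' \<Longrightarrow> x \<in> D w' \<Longrightarrow> M w' x s \<Longrightarrow> \<exists>y\<in>D w'. M w' y b \<and> idpair w' x y"
    "\<And>w' y. w \<sqsubseteq> w' \<Longrightarrow> y \<in> D w' \<Longrightarrow> M w' y b \<Longrightarrow> \<exists>x\<in>D w'. M w' x s \<and> idpair w' x y"
    by auto
  have s_iff: "M w' x s = P w' x" if "w \<sqsubseteq> w'" "x \<in> D w'" for w' x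
    using isset_iff[OF s(2)] that by blast
  have "isset w b graph_id"
    unfolding isset_def
  proof (intro allI impI ballI)
    fix w' q assume w': "w \<sqsubseteq> w'" "q \<in> D w'"
    show "M w' q b = graph_id w' q"
    proof
      assume "M w' q b"
      then show "graph_id w' q" using b(3)[OF w'] s_iff[OF w'(1)] unfolding graph_id_def idpair_def by blast
    next
      assume "graph_id w' q"
      then obtain a y where ay: "a \<in> D w'" "y \<in> D w'" "P w' a" "isset w' y (single a)" "pair w' q a y"
        unfolding graph_id_def by blast
      then obtain q' z where q': "q' \<in> D w'" "M w' q' b" "z \<in> D w'" "isset w' z (single a)" "pair w' q' a z"
        using b(2)[OF w'(1), of a] s_iff[OF w'(1)] unfolding idpair_def by blast
      then have "E w' z y" using isset_unique ay by blast
      then have "pair w' q' a y" using q' pair_E_cong by blast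
      then have "E w' q' q" using pair_unique ay q' w' by blast
      then show "M w' q b" using q' M_cong E_refl by blast
    qed
  qed
  then show ?thesis using b by blast
qed

lemma graph_id_pair:
  assumes "isset w f graph_id" "w \<sqsubseteq> w'" "a \<in> D w'" "P w' a" "y \<in> D w'"
  shows "(\<exists>p\<in>D w'. M w' p f \<and> pair w' p a y) \<longleftrightarrow> isset w' y (single a)"
proof
  assume "\<exists>p\<in>D w'. M w' p f \<and> pair w' p a y"
  then obtain p where p: "p \<in> D w'" "M w' p f" "pair w' p a y" by blast
  then have "graph_id w' p" using isset_iff[OF assms(1,2)] by blast
  then obtain a' y' where *: "a' \<in> D w'" "y' \<in> D w'" "isset w' y' (single a')" "pair w' p a' y'"
    unfolding graph_id_def by blast
  have E: "E w' a a'" "E w' y y'" using pair_inj[OF p(3) *(4) assms(3,5) *(1,2)] by blast+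
  have "isset w' y' (single a)"
  proof (rule isset_transfer[OF *(3)])
    show "single a' w'' x = single a w'' x" if "w' \<sqsubseteq> w''" for w'' x
      using E_mono[OF that E(1)] E_sym E_trans unfolding single_def by blast
  qed
  then show "isset w' y (single a)" by (rule isset_E_cong[OF E_sym[OF E(2)]])
next
  assume y: "isset w' y (single a)"
  obtain p where "p \<in> D w'" "pair w' p a y" using ex_pair assms by blast
  then show "\<exists>p\<in>D w'. M w' p f \<and> pair w' p a y"
    using y isset_iff[OF assms(1,2), of p] assms unfolding graph_id_def by blast
qed

lemma sval_id:
  assumes "isset w f graph_id" "w \<sqsubseteq> w'" "a \<in> D w'" "P w' a" "x \<in> D w'"
  shows "sval f a w' x \<longleftrightarrow> E w' x a"
proof -
  have "sval f a w' x \<longleftrightarrow> (\<exists>y\<in>D w'. isset w' y (single a) \<and> M w' x y)"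
    using graph_id_pair assms unfolding sval_def by blast
  also have "\<dots> \<longleftrightarrow> E w' x a"
  proof -
    have "M w' x y = E w' x a" if "isset w' y (single a)" for y
      using isset_iff[OF that le_refl assms(5)] unfolding single_def .
    then show ?thesis using ex_single[OF assms(3)] by blast
  qed
  finally show ?thesis .
qed

lemma sim_id:
  assumes f: "isset w f graph_id" and "w \<sqsubseteq> w'" "x \<in> D w'"
    and K: "\<And>a. a \<in> D w' \<Longrightarrow> K w' a \<Longrightarrow> P w' a" "\<And>a. E w' a x \<Longrightarrow> K w' a \<Longrightarrow> K w' x"
  shows "sim f K w' x \<longleftrightarrow> K w' x"
proof -
  have "sim f K w' x \<longleftrightarrow> (\<exists>a\<in>D w'. K w' a \<and> E w' x a)"
    using sval_id assms unfolding sim_def by blast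
  then show ?thesis using K E_sym assms E_refl by blast
qed

end

context kripke
begin

lemma sccov_cong:
  "(\<And>w' x. w \<sqsubseteq> w' \<Longrightarrow> x \<in> D w' \<Longrightarrow> K w' x = L w' x) \<Longrightarrow> sccov Cv w a K = sccov Cv w a L"
  unfolding sccov_def using isset_cong[of w K L] by simp

lemma scovers_cong:
  assumes "\<And>w' x. w \<sqsubseteq> w' \<Longrightarrow> x \<in> D w' \<Longrightarrow> K w' x = K' w' x"
    and "\<And>w' x. w \<sqsubseteq> w' \<Longrightarrow> x \<in> D w' \<Longrightarrow> L w' x = L' w' x"
  shows "scovers Cv w K L = scovers Cv w K' L'"
proof -
  have "sccov Cv w' c L = sccov Cv w' c L'" if "w \<sqsubseteq> w'" for w' c
    by (rule sccov_cong) (use assms(2) that le_trans in blast)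
  then show ?thesis using assms(1) unfolding scovers_def by auto
qed

end

context notnot_space
begin

text \<open>Even for a class covering itself a set with its elements has to be exhibited, because
  \<open>sccov\<close> includes sethood.\<close>

lemma scovers_refl:
  assumes "subcl w K P" "\<exists>z\<in>D w. isset w z K"
  shows "scovers C w K K"
  unfolding scovers_def
proof (intro allI impI ballI)
  fix w' c assume w': "w \<sqsubseteq> w'" "c \<in> D w'" "K w' c"
  obtain z where z: "z \<in> D w" "isset w z K" using assms by blast
  have "isset w' z K" "z \<in> D w'" using z w' isset_mono D_mono by blast+
  moreover have "subcl w' (elem z) P"
    using assms(1) z(2) w' unfolding subcl_def isset_def elem_def by (meson le_trans)
  moreover have "M w' c z" "P w' c"
    using isset_iff[OF z(2)] w' assms(1) unfolding subcl_def by blast+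
  ultimately show "sccov C w' c K" using cover_mem unfolding sccov_def by blast
qed

text \<open>By \<open>sval_id\<close> and \<open>sim_id\<close>, values and images under
  \<open>f\<close> turn into singletons and the classes themselves, so the first two covering
  conditions become instances of \<open>scovers_refl\<close>.\<close>

lemma smor_id:
  assumes f: "isset w f graph_id"
  shows "smor P C P C w f"
  unfolding smor_def
proof (intro conjI allI impI ballI)
  fix w' p assume w': "w \<sqsubseteq> w'" "p \<in> D w'" "M w' p f"
  then have "graph_id w' p" using isset_iff[OF f] by blast
  then show "\<exists>a\<in>D w'. \<exists>y\<in>D w'. P w' a \<and> subcl w' (elem y) P \<and> pair w' p a y"
    using subcl_single unfolding graph_id_def by blast
next
  fix w' a assume w': "w \<sqsubseteq> w'" "a \<in> D w'" "P w' a"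
  obtain y where y: "y \<in> D w'" "isset w' y (single a)" using ex_single w' by blast
  have "E w'' y' y"
    if w'': "w' \<sqsubseteq> w''" and y': "y' \<in> D w''" "\<exists>p\<in>D w''. M w'' p f \<and> pair w'' p a y'" for w'' y'
  proof -
    have "w \<sqsubseteq> w''" "a \<in> D w''" "P w'' a" using w' w'' le_trans D_mono P_mono by blast+
    then have "isset w'' y' (single a)" using graph_id_pair[OF f] y' by blast
    then show ?thesis using isset_unique y y' w'' isset_mono D_mono by blast
  qed
  then show "\<exists>y\<in>D w'. (\<exists>p\<in>D w'. M w' p f \<and> pair w' p a y) \<and>
      (\<forall>w''. w' \<sqsubseteq> w'' \<longrightarrow> (\<forall>y'\<in>D w''. (\<exists>p\<in>D w''. M w'' p f \<and> pair w'' p a y') \<longrightarrow> E w'' y' y))"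
    using y graph_id_pair[OF f w' y(1)] by blast
next
  have "sim f P w' x = P w' x" if "w \<sqsubseteq> w'" "x \<in> D w'" for w' x
    by (rule sim_id[OF f that]) (use P_cong in auto)
  then have "scovers C w (sim f P) P = scovers C w P P" "scovers C w P (sim f P) = scovers C w P P"
    by (auto intro!: scovers_cong)
  moreover have "scovers C w P P" by (rule scovers_refl[OF _ P_set]) (auto simp: subcl_def)
  ultimately show "scovers C w (sim f P) P" "scovers C w P (sim f P)" by simp_all
next
  fix w' a b assume w': "w \<sqsubseteq> w'" "a \<in> D w'" "b \<in> D w'" and P: "P w' a \<and> P w' b"
  let ?K = "sdown P C (single a) (single b)"
  obtain u z where uz: "u \<in> D w'" "isset w' u (single a)" "z \<in> D w'" "isset w' z (single b)"
    using ex_single[OF w'(2)] ex_single[OF w'(3)] by blast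
  have eq: "sdown P C (elem u) (elem z) w'' x = ?K w'' x" if "w' \<sqsubseteq> w''" for w'' x
    using isset_iff[OF uz(2) that] isset_iff[OF uz(4) that] unfolding sdown_def elem_def by blast
  have "subcl w' (elem u) P" "subcl w' (elem z) P" using subcl_single P uz by blast+
  then obtain y where y: "y \<in> D w'" "isset w' y (sdown P C (elem u) (elem z))"
    using sdown_set uz by blast
  have "isset w' y ?K" by (rule isset_transfer[OF y(2)]) (rule eq)
  then have set: "\<exists>z\<in>D w'. isset w' z ?K" using y by blast
  \<comment> \<open>A class denoted by a formula is closed under \<open>E\<close>, which
    \<open>sim_id\<close> requires of \<open>?K\<close>.\<close>
  have K: "denotes (\<lambda>_. a) 2 (case_nat a (\<lambda>_. b)) (down A (sing 0) (sing 1)) ?K"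
    using denotes_down[OF A denotes_sing[of 0 2 "\<lambda>_. a" "case_nat a (\<lambda>_. b)"]
        denotes_sing[of 1 2 "\<lambda>_. a" "case_nat a (\<lambda>_. b)"]] by simp
  have sim: "sim f ?K w'' x = ?K w'' x" if "w' \<sqsubseteq> w''" "x \<in> D w''" for w'' x
    by (rule sim_id[OF f le_trans[OF w'(1) that(1)] that(2)])
      (simp add: sdown_def, rule denotes_E_cong[OF K])
  have "sval f c w'' x = single c w'' x" if "w' \<sqsubseteq> w''" "x \<in> D w''" "c = a \<or> c = b" for w'' x c
    using sval_id[OF f le_trans[OF w'(1) that(1)], of c x] that w' P P_mono D_mono
    unfolding single_def by blast
  then have "sdown P C (sval f a) (sval f b) w'' x = ?K w'' x" if "w' \<sqsubseteq> w''" for w'' x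
    using that unfolding sdown_def by blast
  then have "scovers C w' (sdown P C (sval f a) (sval f b)) (sim f ?K) = scovers C w' ?K ?K"
    by (rule scovers_cong) (use sim in auto)
  moreover have "scovers C w' ?K ?K"
    by (rule scovers_refl[OF _ set]) (auto simp: subcl_def sdown_def)
  ultimately show "scovers C w' (sdown P C (sval f a) (sval f b)) (sim f ?K)" by simp
next
  fix w' a u assume w': "w \<sqsubseteq> w'" "a \<in> D w'" "u \<in> D w'" and P: "P w' a \<and> subcl w' (elem u) P"
    and C: "C w' a u"
  show "scovers C w' (sval f a) (sim f (elem u))"
    unfolding scovers_def
  proof (intro allI impI ballI)
    fix w'' c assume w'': "w' \<sqsubseteq> w''" "c \<in> D w''" "sval f a w'' c"
    have le: "w \<sqsubseteq> w''" using w' w'' le_trans by blast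
    have "E w'' c a" using sval_id[OF f le] w' w'' P P_mono D_mono by blast
    then have "C w'' c u" using space_cov_cong[OF A] space_cov_mono[OF A w''(1) C] E_sym E_refl by blast
    moreover have "isset w'' u (sim f (elem u))"
      unfolding isset_def
    proof (intro allI impI ballI)
      fix w3 x assume w3: "w'' \<sqsubseteq> w3" "x \<in> D w3"
      have "sim f (elem u) w3 x = elem u w3 x"
      proof (rule sim_id[OF f])
        show "P w3 a" if "elem u w3 a" for a
          using that P subcl_P le_trans w'' w3 unfolding elem_def by blast
        show "elem u w3 x" if "E w3 a x" "elem u w3 a" for a
          using that M_cong E_refl unfolding elem_def by blast
      qed (use w3 le le_trans in blast)+
      then show "M w3 x u = sim f (elem u) w3 x" by (simp add: elem_def)
    qed
    ultimately show "sccov C w'' c (sim f (elem u))"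
      using w' w'' D_mono unfolding sccov_def by blast
  qed
qed

end

section \<open>Uniqueness of morphisms\<close>

context kripke
begin

lemma space_of_denotes: "space_denotes \<rho> (space_of s c)
    (\<lambda>w a. sem w (case_nat a \<rho>) s) (\<lambda>w a u. sem w (case_nat a (case_nat u \<rho>)) c)"
  by (simp add: space_denotes_def space_of_def sat_sch1 sat_sch2)

lemma smor_pairs:
  assumes "smor P C Q Cq w f" "p \<in> D w" "M w p f"
  shows "\<exists>a\<in>D w. \<exists>y\<in>D w. P w a \<and> subcl w (elem y) Q \<and> pair w p a y"
  by (rule assms(1)[unfolded smor_def, THEN conjunct1, THEN conjunct1, rule_format, OF le_refl assms(2,3)])

lemma smor_ex1:
  assumes "smor P C Q Cq w f" "a \<in> D w" "P w a"
  obtains y where "y \<in> D w" "\<exists>p\<in>D w. M w p f \<and> pair w p a y"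
    and "\<And>w' y'. w \<sqsubseteq> w' \<Longrightarrow> y' \<in> D w' \<Longrightarrow> \<exists>p\<in>D w'. M w' p f \<and> pair w' p a y' \<Longrightarrow> E w' y' y"
proof -
  obtain y where y: "y \<in> D w" "(\<exists>p\<in>D w. M w p f \<and> pair w p a y) \<and>
      (\<forall>w'. w \<sqsubseteq> w' \<longrightarrow> (\<forall>y'\<in>D w'. (\<exists>p\<in>D w'. M w' p f \<and> pair w' p a y') \<longrightarrow> E w' y' y))"
    by (rule bexE[OF assms(1)[unfolded smor_def, THEN conjunct1, THEN conjunct2, THEN spec, THEN mp,
          OF le_refl, THEN bspec, OF assms(2), THEN mp, OF assms(3)]])
  show thesis by (rule that[OF y(1)]) (use y(2) in blast)+
qed

lemma smor_total:
  assumes "smor P C Q Cq w f"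
  shows "scovers Cq w Q (sim f P)"
  by (rule assms[unfolded smor_def, THEN conjunct2, THEN conjunct1, THEN conjunct2])

lemma smor_cover:
  assumes "smor P C Q Cq w f" "a \<in> D w" "u \<in> D w" "P w a" "subcl w (elem u) P" "C w a u"
  shows "scovers Cq w (sval f a) (sim f (elem u))"
  by (rule assms(1)[unfolded smor_def, THEN conjunct2, THEN conjunct2, THEN conjunct2, rule_format,
        OF le_refl assms(2,3) conjI[OF assms(4,5)] assms(6)])

lemma sft_trans:
  assumes "sft P Cv w" "a \<in> D w" "u \<in> D w" "z \<in> D w" "P w a" "subcl w (elem u) P" "subcl w (elem z) P"
    and "Cv w a u" "\<And>w' b. w \<sqsubseteq> w' \<Longrightarrow> b \<in> D w' \<Longrightarrow> M w' b u \<Longrightarrow> Cv w' b z"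
  shows "Cv w a z"
  by (rule assms(1)[unfolded sft_def, THEN conjunct2, THEN conjunct2, THEN conjunct1, rule_format,
        OF le_refl assms(2-4)]) (use assms in blast)+

lemma scoversD: "scovers Cv w K L \<Longrightarrow> c \<in> D w \<Longrightarrow> K w c \<Longrightarrow> sccov Cv w c L"
  unfolding scovers_def using le_refl by blast

end

text \<open>\<open>sval\<close> is the union of all values of \<open>f\<close> at \<open>a\<close>,
  and there is exactly one value \<open>y\<close>. That \<open>y\<close> lies in the codomain is
  known only for some decomposition (b, y') of the same pair, whence the appeal to
  \<open>pair_inj\<close>.\<close>

lemma (in czf_model) morphism_value:
  assumes f: "smor P C Q Cq w f" and a: "a \<in> D w" "P w a"
  shows "\<exists>y\<in>D w. isset w y (sval f a) \<and> subcl w (elem y) Q"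
proof -
  obtain y where y: "y \<in> D w" "\<exists>p\<in>D w. M w p f \<and> pair w p a y"
    "\<And>w' y'. w \<sqsubseteq> w' \<Longrightarrow> y' \<in> D w' \<Longrightarrow> \<exists>p\<in>D w'. M w' p f \<and> pair w' p a y' \<Longrightarrow> E w' y' y"
    using smor_ex1[OF f a] by blast
  then obtain p where p: "p \<in> D w" "M w p f" "pair w p a y" by blast
  obtain b y' where b: "b \<in> D w" "y' \<in> D w" "subcl w (elem y') Q" "pair w p b y'"
    using smor_pairs[OF f p(1,2)] by blast
  have E: "E w y' y" using pair_inj[OF p(3) b(4) a(1) y(1) b(1,2)] E_sym by blast
  have "subcl w (elem y) Q"
    using b(3) M_cong[OF E_refl E_sym[OF E_mono[OF _ E]]] unfolding subcl_def elem_def by blast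
  moreover have "isset w y (sval f a)"
    unfolding isset_def
  proof (intro allI impI ballI)
    fix w' x assume w': "w \<sqsubseteq> w'" "x \<in> D w'"
    show "M w' x y = sval f a w' x"
    proof
      assume "M w' x y"
      then show "sval f a w' x"
        using D_mono[OF w'(1) y(1)] D_mono[OF w'(1) p(1)] M_mono[OF w'(1) p(2)] pair_mono[OF p(3) w'(1)]
        unfolding sval_def by blast
    next
      assume "sval f a w' x"
      then obtain z q where "z \<in> D w'" "q \<in> D w'" "M w' q f" "pair w' q a z" "M w' x z"
        unfolding sval_def by blast
      then show "M w' x y" using y(3) w' M_cong E_refl by blast
    qed
  qed
  ultimately show ?thesis using y by blast
qed

context notnot_space
begin

text \<open>
  Where \<open>a\<close> is covered by the empty set, so is \<open>f a\<close>.  Elsewhere all points are covered by \<open>{a}\<close>,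
  hence all points of the codomain are covered by \<open>g a\<close>.
\<close>

lemma morphisms_agree:
  assumes T: "space_denotes \<rho> T Q Cq" and ft: "sft Q Cq w"
    and f: "smor P C Q Cq w f" and g: "smor P C Q Cq w g" and a: "a \<in> D w" "P w a"
  shows "scovers Cq w (sval f a) (sval g a)"
  unfolding scovers_def
proof (intro allI impI ballI)
  fix w' c assume w': "w \<sqsubseteq> w'" "c \<in> D w'" "sval f a w' c"
  have f': "smor P C Q Cq w' f" and g': "smor P C Q Cq w' g" and ft': "sft Q Cq w'"
    using smor_mono[OF A T w'(1)] f g sft_mono[OF T w'(1)] ft by blast+
  have a': "a \<in> D w'" "P w' a" using a w' D_mono P_mono by blast+
  obtain yf where yf: "isset w' yf (sval f a)" "subcl w' (elem yf) Q"
    using morphism_value[of P C Q Cq, OF f' a'] by blast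
  have "M w' c yf" using isset_iff[OF yf(1)] w' by blast
  then have Qc: "Q w' c" using yf(2) w' unfolding subcl_def elem_def by blast
  obtain y where y: "y \<in> D w'" "isset w' y (sval g a)" "subcl w' (elem y) Q"
    using morphism_value[of P C Q Cq, OF g' a'] by blast
  have "Cq w' c y"
  proof (cases "R w' a")
    case True
    obtain z0 where z0: "z0 \<in> D w'" "zero w' z0" using ex_zero by blast
    have empty: "\<not> M w'' x z0" if "w' \<sqsubseteq> w''" for w'' x
      using isset_iff[OF z0(2)[unfolded zero_def] that] M_D by blast
    then have sub: "subcl w' (elem z0) P" unfolding subcl_def elem_def by blast
    then have "C w' a z0" using C_iff True a' z0 by blast
    then have "sccov Cq w' c (sim f (elem z0))"
      using scoversD[OF smor_cover[OF f' a'(1) z0(1) a'(2) sub]] w' by blast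
    then obtain z where z: "z \<in> D w'" "isset w' z (sim f (elem z0))" "Cq w' c z"
      unfolding sccov_def by blast
    \<comment> \<open>The image of the empty set is empty. So \<open>c\<close> is covered by an
      empty set, and transitivity to \<open>y\<close> holds vacuously.\<close>
    have "\<not> M w'' b z" if "w' \<sqsubseteq> w''" for w'' b
      using isset_iff[OF z(2) that] M_D empty[OF that] unfolding sim_def elem_def by blast
    moreover from this have "subcl w' (elem z) Q" unfolding subcl_def elem_def by blast
    ultimately show ?thesis using sft_trans[OF ft' w'(2) z(1) y(1) Qc _ y(3) z(3)] by blast
  next
    case False
    then have Ua: "U w' a" using P_iff a' by blast
    obtain u where u: "u \<in> D w'" "isset w' u (single a)" using ex_single a' by blast
    have u_iff: "M w'' x u = E w'' x a" if "w' \<sqsubseteq> w''" "x \<in> D w''" for w'' x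
      using isset_iff[OF u(2) that] unfolding single_def .
    have sub: "subcl w'' (elem u) P" if "w' \<sqsubseteq> w''" for w''
      using subcl_mono[OF subcl_single[OF a'(2) u(2)] that] .
    have covered: "C w'' b u" if "w' \<sqsubseteq> w''" "b \<in> D w''" "P w'' b" for w'' b
    proof (cases "R w'' b")
      case True
      then show ?thesis using C_iff[OF that(2) D_mono[OF that(1) u(1)] that(3) sub[OF that(1)]] by blast
    next
      case False
      then have "E w'' b a" using P_iff U_unique U_mono Ua a' D_mono that by blast
      then show ?thesis using cover_mem u_iff sub that by blast
    qed
    have sim: "sim g (elem u) w'' x = sval g a w'' x" if "w' \<sqsubseteq> w''" for w'' x
      using u_iff[OF that] sval_cong D_mono[OF that a'(1)] E_refl unfolding sim_def elem_def by blast
    have "sccov Cq w' c (sim g P)"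
      by (rule scoversD[OF smor_total[OF g'] w'(2) Qc])
    then obtain z where z: "z \<in> D w'" "isset w' z (sim g P)" "Cq w' c z"
      unfolding sccov_def by blast
    \<comment> \<open>Every element of g(S) lies in some g(a2). Since {a} covers a2, the element is
      covered by the image of {a}, which is g(a); composing with the covering of \<open>c\<close> by
      g(S) gives the claim.\<close>
    have z_elem: "Q w'' b \<and> Cq w'' b y" if w'': "w' \<sqsubseteq> w''" "b \<in> D w''" "M w'' b z" for w'' b
    proof -
      have "sim g P w'' b" using isset_iff[OF z(2) w''(1,2)] w''(3) by blast
      then obtain a2 where a2: "a2 \<in> D w''" "P w'' a2" "sval g a2 w'' b" unfolding sim_def by blast
      obtain y2 where "isset w'' y2 (sval g a2)" "subcl w'' (elem y2) Q"
        using morphism_value[of P C Q Cq, OF smor_mono[OF A T w''(1) g'] a2(1,2)] by blast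
      then have Qb: "Q w'' b"
        using isset_iff[of w'' y2 "sval g a2" w'' b] a2(3) w''(2) unfolding subcl_def elem_def by blast
      have "sccov Cq w'' b (sim g (elem u))"
        by (rule scoversD[OF smor_cover[OF smor_mono[OF A T w''(1) g'] a2(1) D_mono[OF w''(1) u(1)] a2(2)
              sub[OF w''(1)] covered[OF w''(1) a2(1,2)]] w''(2) a2(3)])
      then obtain z2 where z2: "z2 \<in> D w''" "isset w'' z2 (sim g (elem u))" "Cq w'' b z2"
        unfolding sccov_def by blast
      have "isset w'' z2 (sval g a)"
        by (rule isset_transfer[OF z2(2)]) (use sim w'' le_trans in blast)
      then have "E w'' z2 y"
        using isset_unique z2(1) y isset_mono D_mono w''(1) by blast
      then show ?thesis using space_cov_cong[OF T E_refl _ z2(3)] Qb by blast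
    qed
    then have "subcl w' (elem z) Q" unfolding subcl_def elem_def by blast
    then show ?thesis using sft_trans[OF ft' w'(2) z(1) y(1) Qc _ y(3) z(3)] z_elem by blast
  qed
  then show "sccov Cq w' c (sval g a)" using y unfolding sccov_def by blast
qed

lemma sim_comp_id:
  assumes p: "isset w p graph_id" and w': "w \<sqsubseteq> w'" "a \<in> D w'" "P w' a"
  shows "scovers Cq w' (sim f (sval p a)) L = scovers Cq w' (sval f a) L"
    and "scovers Cq w' L (sim f (sval p a)) = scovers Cq w' L (sval f a)"
proof -
  have "sim f (sval p a) w'' x = sval f a w'' x" if "w' \<sqsubseteq> w''" for w'' x
  proof -
    have a: "a \<in> D w''" "P w'' a" "w \<sqsubseteq> w''" using w' that D_mono P_mono le_trans by blast+
    have "sval p a w'' b = E w'' b a" if "b \<in> D w''" for b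
      by (rule sval_id[OF p a(3,1,2) that])
    then show ?thesis using a(1) sval_cong E_refl unfolding sim_def by blast
  qed
  then show "scovers Cq w' (sim f (sval p a)) L = scovers Cq w' (sval f a) L"
    and "scovers Cq w' L (sim f (sval p a)) = scovers Cq w' L (sval f a)"
    by (auto intro!: scovers_cong)
qed

end

section \<open>Identities as product projections\<close>

definition is_identity :: "space \<Rightarrow> var \<Rightarrow> form" where
  "is_identity A f = (f \<^bold>\<equiv> (\<lambda>q. \<^bold>\<exists>a. \<^bold>\<exists>y. pts A a \<^bold>\<and> y \<^bold>\<equiv> sing a \<^bold>\<and> is_pair q a y))"

text \<open>Level 0 at depth 1 is index 0, the variable that \<open>sch\<close> replaces.\<close>

definition identity_fm :: "space \<Rightarrow> fm" where
  "identity_fm A = is_identity A 0 1"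

context notnot_space
begin

lemma sat_identity:
  assumes "f < d"
  shows "sat \<rho> w d v (sch (identity_fm A) [f]) = isset w (v f) graph_id"
proof -
  have "denotes \<rho> 1 (\<lambda>_. v f) (\<lambda>q. \<^bold>\<exists>a. \<^bold>\<exists>y. pts A a \<^bold>\<and> y \<^bold>\<equiv> sing a \<^bold>\<and> is_pair q a y) graph_id"
    by (rule denotesI)
      (simp add: graph_id_def sat_ex sat_conj sat_pts[OF A] sat_is_set_of[OF denotes_sing] sat_is_pair)
  then show ?thesis
    using assms unfolding identity_fm_def One_nat_def
    by (simp add: sat_sch1 sem_sat1 is_identity_def sat_is_set_of)
qed

lemma sat_ex1_identity: "sat \<rho> w 0 v (\<^bold>\<exists>\<^bold>!f. sch (identity_fm A) [f])"
  unfolding sat_ex1 using ex_graph_id isset_unique isset_mono D_mono by (simp add: sat_identity) meson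

lemma sat_identity_morphism:
  assumes "\<And>\<rho>. space_denotes \<rho> B P C"
  shows "sat \<rho> w 0 v (\<^bold>\<forall>f. sch (identity_fm A) [f] \<^bold>\<longrightarrow> morphism A B f)"
  unfolding sat_all_imp by (auto simp: sat_identity sat_morphism[OF A assms] smor_id)

text \<open>The mediating morphism is \<open>f\<close> itself: composed with the second identity it
  still equals \<open>g\<close>, because \<open>f\<close> and \<open>g\<close> agree. The product
  \<open>B\<close> is kept apart from the factor \<open>A\<close>, since a definable product must
  have the form \<open>space_of s c\<close>; the two have the same meaning in the model.\<close>

lemma sat_universal:
  assumes B: "\<And>\<rho>. space_denotes \<rho> B P C" and T: "space_denotes \<rho> T Q Cq"
  shows "sat \<rho> w 0 v (formal_topology T \<^bold>\<longrightarrow>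
        (\<^bold>\<forall>p1. \<^bold>\<forall>p2. sch (identity_fm A) [p1] \<^bold>\<and> sch (identity_fm A) [p2] \<^bold>\<longrightarrow>
        (\<^bold>\<forall>f. \<^bold>\<forall>g. morphism A T f \<^bold>\<and> morphism A T g \<^bold>\<longrightarrow>
        (\<^bold>\<exists>h. (morphism B T h \<^bold>\<and> mor_eq A T (mor_comp h p1) (val_at f) \<^bold>\<and> mor_eq A T (mor_comp h p2) (val_at g)) \<^bold>\<and>
          (\<^bold>\<forall>k. morphism B T k \<^bold>\<and> mor_eq A T (mor_comp k p1) (val_at f) \<^bold>\<and> mor_eq A T (mor_comp k p2) (val_at g) \<^bold>\<longrightarrow>
            mor_eq B T (val_at k) (val_at h))))))"
proof -
  have comp: "h < d \<Longrightarrow> p < d \<Longrightarrow>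
      denotes \<rho> (Suc d) (v(d := a)) (mor_comp h p d) (sim (v h) (sval (v p) a))" for h p d v a
    using denotes_mor_comp[of h "Suc d" p d \<rho> "v(d := a)"] by simp
  have val: "h < d \<Longrightarrow> denotes \<rho> (Suc d) (v(d := a)) (val_at h d) (sval (v h) a)" for h d v a
    using denotes_val_at[of h "Suc d" d \<rho> "v(d := a)"] by simp
  define commutes where "commutes w h p f \<longleftrightarrow> (\<forall>w'. w \<sqsubseteq> w' \<longrightarrow> (\<forall>a\<in>D w'. P w' a \<longrightarrow>
      scovers Cq w' (sim h (sval p a)) (sval f a) \<and> scovers Cq w' (sval f a) (sim h (sval p a))))"
    for w h p f
  have "\<forall>w1. w \<sqsubseteq> w1 \<longrightarrow> sft Q Cq w1 \<longrightarrow> (\<forall>w2. w1 \<sqsubseteq> w2 \<longrightarrow> (\<forall>p1\<in>D w2. \<forall>p2\<in>D w2.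
    isset w2 p1 graph_id \<and> isset w2 p2 graph_id \<longrightarrow> (\<forall>w3. w2 \<sqsubseteq> w3 \<longrightarrow> (\<forall>f\<in>D w3. \<forall>g\<in>D w3.
    smor P C Q Cq w3 f \<and> smor P C Q Cq w3 g \<longrightarrow>
    (\<exists>h\<in>D w3. (smor P C Q Cq w3 h \<and> commutes w3 h p1 f \<and> commutes w3 h p2 g) \<and>
      (\<forall>w4. w3 \<sqsubseteq> w4 \<longrightarrow> (\<forall>k\<in>D w4.
        smor P C Q Cq w4 k \<and> commutes w4 k p1 f \<and> commutes w4 k p2 g \<longrightarrow>
        (\<forall>w5. w4 \<sqsubseteq> w5 \<longrightarrow> (\<forall>a\<in>D w5. P w5 a \<longrightarrow>
          scovers Cq w5 (sval k a) (sval h a) \<and> scovers Cq w5 (sval h a) (sval k a))))))))))"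
  proof (intro allI impI ballI)
    fix w1 w2 p1 p2 w3 f g
    assume ft1: "sft Q Cq w1" and w2: "w1 \<sqsubseteq> w2" and p12: "isset w2 p1 graph_id \<and> isset w2 p2 graph_id"
      and w3: "w2 \<sqsubseteq> w3" and D: "f \<in> D w3" "g \<in> D w3"
      and fg: "smor P C Q Cq w3 f \<and> smor P C Q Cq w3 g"
    have p: "isset w3 p1 graph_id" "isset w3 p2 graph_id" using isset_mono p12 w3 by blast+
    have ft: "sft Q Cq w3" using sft_mono[OF T le_trans[OF w2 w3] ft1] .
    have agree: "scovers Cq w5 (sval h a) (sval k a)"
      if "smor P C Q Cq w4 h" "smor P C Q Cq w4 k" "w3 \<sqsubseteq> w4" "w4 \<sqsubseteq> w5" "a \<in> D w5" "P w5 a" for h k w4 w5 a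
      using morphisms_agree[OF T sft_mono[OF T le_trans[OF that(3,4)] ft]] smor_mono[OF A T that(4)] that by blast
    \<comment> \<open>With \<open>h\<close> chosen as \<open>f\<close>, the first triangle compares
      \<open>f\<close> with itself and the second compares \<open>f\<close> and \<open>g\<close> in
      both directions.\<close>
    note same = agree[OF _ _ le_refl, OF conjunct1[OF fg] conjunct1[OF fg]]
      agree[OF _ _ le_refl, OF conjunct1[OF fg] conjunct2[OF fg]]
      agree[OF _ _ le_refl, OF conjunct2[OF fg] conjunct1[OF fg]]
    have unique: "scovers Cq w5 (sval k a) (sval f a) \<and> scovers Cq w5 (sval f a) (sval k a)"
      if "w3 \<sqsubseteq> w4" "smor P C Q Cq w4 k" "w4 \<sqsubseteq> w5" "a \<in> D w5" "P w5 a" for w4 k w5 a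
      using agree[of w4 f k w5 a] agree[of w4 k f w5 a] smor_mono[OF A T that(1) conjunct1[OF fg]] that by blast
    show "\<exists>h\<in>D w3. (smor P C Q Cq w3 h \<and> commutes w3 h p1 f \<and> commutes w3 h p2 g) \<and>
      (\<forall>w4. w3 \<sqsubseteq> w4 \<longrightarrow> (\<forall>k\<in>D w4.
        smor P C Q Cq w4 k \<and> commutes w4 k p1 f \<and> commutes w4 k p2 g \<longrightarrow>
        (\<forall>w5. w4 \<sqsubseteq> w5 \<longrightarrow> (\<forall>a\<in>D w5. P w5 a \<longrightarrow>
          scovers Cq w5 (sval k a) (sval h a) \<and> scovers Cq w5 (sval h a) (sval k a)))))"
      using fg D(1) same unique
      by (intro bexI[of _ f]) (simp_all add: commutes_def sim_comp_id[OF p(1)] sim_comp_id[OF p(2)])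
  qed
  then show ?thesis
    unfolding sat_imp[of _ _ 0] sat_all2_imp sat_conj sat_ex sat_all_imp commutes_def
    by (simp add: sat_formal_topology[OF T] sat_identity sat_morphism[OF A T] sat_morphism[OF B T]
        sat_mor_eq[OF A T comp val] sat_mor_eq[OF B T val val])
qed

end

lemma (in notnot_space) sat_formal_topology_denoted:
  "space_denotes \<rho> B P C \<Longrightarrow> sat \<rho> w d v (formal_topology B)"
  by (simp add: sat_formal_topology sft)

section \<open>From Kripke models to derivability\<close>

lemma CZF_provesI:
  assumes "\<And>le (D :: nat set \<times> fm set \<Rightarrow> nat set) M E w \<rho>.
    czf_model le D M E \<Longrightarrow> kripke.sat le D M E \<rho> w 0 \<rho> F"
  shows "CZF \<turnstile> F"
  unfolding CZF_proves_def
proof (rule CZF.completeness)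
  fix le :: "nat set \<times> fm set \<Rightarrow> nat set \<times> fm set \<Rightarrow> bool" and D :: "nat set \<times> fm set \<Rightarrow> nat set"
    and M E w and e :: "nat \<Rightarrow> nat"
  assume "kripke_model le D M E CZF_axioms"
  then interpret czf_model le D M E by (rule czf_model.intro)
  show "sem w e (F 0)" using assms[OF czf_model_axioms, of e w] by (simp add: sat_0)
qed

text \<open>The predicates \<open>P\<close>, \<open>C\<close>, \<open>R\<close>, \<open>U\<close>
  live in a particular model, so they are obtained anew in each one; only the formulas for the
  spaces and the projections are common to all models.\<close>

lemma identity_product:
  assumes model: "\<And>le (D :: nat set \<times> fm set \<Rightarrow> nat set) M E. czf_model le D M E \<Longrightarrow>
      \<exists>P C R U. notnot_space le D M E P C R U A \<and> (\<forall>\<rho>. kripke.space_denotes le D M E \<rho> B P C)"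
    and "definable 1 (identity_fm A)"
  shows "is_product B A A (identity_fm A) (identity_fm A)"
proof -
  have *: "CZF \<turnstile> F"
    if "\<And>le (D :: nat set \<times> fm set \<Rightarrow> nat set) M E P C R U \<rho> w. notnot_space le D M E P C R U A \<Longrightarrow>
      (\<And>\<rho>. kripke.space_denotes le D M E \<rho> B P C) \<Longrightarrow> kripke.sat le D M E \<rho> w 0 \<rho> F" for F
  proof (rule CZF_provesI)
    fix le and D :: "nat set \<times> fm set \<Rightarrow> nat set" and M E w \<rho>
    assume "czf_model le D M E"
    then obtain P C R U where "notnot_space le D M E P C R U A"
      "\<And>\<rho>. kripke.space_denotes le D M E \<rho> B P C" using model by blast
    then show "kripke.sat le D M E \<rho> w 0 \<rho> F" by (rule that)
  qed
  have kripke: "notnot_space le D M E P C R U A \<Longrightarrow> kripke le D M E"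
    for le and D :: "nat set \<times> fm set \<Rightarrow> nat set" and M E P C R U
    by (simp add: notnot_space_def czf_model_def kripke_model_def)
  have "CZF \<turnstile> formal_topology A"
    by (rule *) (rule notnot_space.sat_formal_topology_denoted, assumption, rule notnot_space.A)
  moreover have "CZF \<turnstile> formal_topology B"
    by (rule *) (rule notnot_space.sat_formal_topology_denoted)
  moreover have "CZF \<turnstile> (\<^bold>\<exists>\<^bold>!f. sch (identity_fm A) [f])"
    by (rule *) (rule notnot_space.sat_ex1_identity)
  moreover have "CZF \<turnstile> (\<^bold>\<forall>f. sch (identity_fm A) [f] \<^bold>\<longrightarrow> morphism A B f)"
    by (rule *) (rule notnot_space.sat_identity_morphism)
  ultimately show ?thesis
    unfolding is_product_def Let_def using assms(2)
    by (intro conjI allI)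
      (assumption | rule *, rule notnot_space.sat_universal, assumption, assumption,
        rule kripke.space_of_denotes, rule kripke, assumption)+
qed

section \<open>The two spaces as instances\<close>

context czf_model
begin

lemma space_denotes_pow_notnot:
  "space_denotes \<rho> pow_notnot zero (\<lambda>w a u. \<forall>w'. w \<sqsubseteq> w' \<longrightarrow> (\<exists>w''. w' \<sqsubseteq> w'' \<and> M w'' a u))"
  by (simp add: space_denotes_def pow_notnot_def denotesD[OF denotes_is_zero] sat_not sat_mem)

lemma zero_unique: "zero w x \<Longrightarrow> zero w y \<Longrightarrow> x \<in> D w \<Longrightarrow> y \<in> D w \<Longrightarrow> E w x y"
  unfolding zero_def by (rule isset_unique)

lemma one_unique: "one w x \<Longrightarrow> one w y \<Longrightarrow> x \<in> D w \<Longrightarrow> y \<in> D w \<Longrightarrow> E w x y"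
  unfolding one_def by (rule isset_unique)

lemma isset_single_zero:
  assumes "z \<in> D w" "zero w z" "isset w s (single z)"
  shows "isset w s zero"
proof (rule isset_transfer[OF assms(3)])
  show "single z w' x = zero w' x" if "w \<sqsubseteq> w'" "x \<in> D w'" for w' x
    using that assms zero_unique zero_E_cong zero_mono D_mono E_sym unfolding single_def by meson
qed

lemma ex_one: "\<exists>x\<in>D w. one w x"
  using ex_zero ex_single isset_single_zero unfolding one_def by meson

lemma zero_one:
  assumes "zero w x" "one w x"
  shows False
proof -
  obtain z where "z \<in> D w" "zero w z" using ex_zero by blast
  then show False
    using isset_iff[of w x "\<lambda>_ _. False" w z] isset_iff[of w x zero w z] assms
    unfolding zero_def[of w x] one_def by blast
qed

lemma notnot_space_pow_notnot:
  "notnot_space (\<sqsubseteq>) D M E zero (\<lambda>w a u. \<forall>w'. w \<sqsubseteq> w' \<longrightarrow> (\<exists>w''. w' \<sqsubseteq> w'' \<and> M w'' a u))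
    (\<lambda>_ _. False) zero pow_notnot"
proof unfold_locales
  show "\<exists>r\<in>D w. isset w r (\<lambda>_ _. False)" for w
    using ex_zero unfolding zero_def .
  show "\<exists>s\<in>D w. isset w s zero" for w
    using ex_one unfolding one_def .
qed (auto intro: space_denotes_pow_notnot zero_unique zero_mono)

definition le_dm :: "'w \<Rightarrow> 'a \<Rightarrow> 'a \<Rightarrow> bool" where
  "le_dm w x y \<longleftrightarrow> E w x y \<or> zero w x \<and> one w y"

definition pts_dm :: "'w \<Rightarrow> 'a \<Rightarrow> bool" where
  "pts_dm w x \<longleftrightarrow> zero w x \<or> one w x"

definition cov_dm :: "'w \<Rightarrow> 'a \<Rightarrow> 'a \<Rightarrow> bool" where
  "cov_dm w a u \<longleftrightarrow> (\<forall>w'. w \<sqsubseteq> w' \<longrightarrow> (\<forall>y\<in>D w'. pts_dm w' y \<longrightarrow>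
    (\<forall>w''. w' \<sqsubseteq> w'' \<longrightarrow> (\<forall>x\<in>D w''. M w'' x u \<longrightarrow> le_dm w'' x y)) \<longrightarrow> le_dm w' a y))"

lemma sat_le_DM: "x < d \<Longrightarrow> y < d \<Longrightarrow> sat \<rho> w d v (le_DM x y) = le_dm w (v x) (v y)"
  by (simp add: le_DM_def le_dm_def sat_disj sat_conj sat_eq denotesD[OF denotes_is_zero] denotesD[OF denotes_is_one])

lemma sat_pts_DM: "x < d \<Longrightarrow> sat \<rho> w d v (pts_DM x) = pts_dm w (v x)"
  by (simp add: pts_DM_def pts_dm_def sat_disj denotesD[OF denotes_is_zero] denotesD[OF denotes_is_one])

lemma space_denotes_S_DM: "space_denotes \<rho> S_DM pts_dm cov_dm"
  unfolding space_denotes_def S_DM_def cov_dm_def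
  by (simp add: sat_pts_DM sat_all_imp_imp sat_all_imp sat_mem sat_le_DM)

text \<open>If 1 never enters \<open>u\<close> from some world on, then all elements of
  \<open>u\<close> are 0 there, so 0 is an upper bound and 1 \<le> 0 would follow. Conversely an
  upper bound is 0 or 1, and a later world with 1 in \<open>u\<close> excludes 0.\<close>

lemma cov_dm_iff:
  assumes D: "a \<in> D w" "u \<in> D w" and a: "pts_dm w a" and u: "subcl w (elem u) pts_dm"
  shows "cov_dm w a u \<longleftrightarrow> zero w a \<or> (\<forall>w'. w \<sqsubseteq> w' \<longrightarrow> (\<exists>w''. w' \<sqsubseteq> w'' \<and> M w'' a u))"
proof
  assume c: "cov_dm w a u"
  show "zero w a \<or> (\<forall>w'. w \<sqsubseteq> w' \<longrightarrow> (\<exists>w''. w' \<sqsubseteq> w'' \<and> M w'' a u))"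
  proof (rule ccontr)
    assume "\<not> ?thesis"
    then obtain w' where w': "w \<sqsubseteq> w'" "\<And>w''. w' \<sqsubseteq> w'' \<Longrightarrow> \<not> M w'' a u" and "\<not> zero w a" by blast
    then have a1: "one w' a" using a one_mono unfolding pts_dm_def by blast
    obtain z where z: "z \<in> D w'" "zero w' z" using ex_zero by blast
    have "le_dm w'' x z" if x: "w' \<sqsubseteq> w''" "x \<in> D w''" "M w'' x u" for w'' x
    proof -
      have "w \<sqsubseteq> w''" using w' x le_trans by blast
      then have "pts_dm w'' x" using u x unfolding subcl_def elem_def by blast
      moreover have "\<not> one w'' x"
      proof
        assume "one w'' x"
        then have "E w'' x a" using one_unique one_mono[OF a1 x(1)] x(2) D_mono \<open>w \<sqsubseteq> w''\<close> D(1) by blast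
        then show False using M_cong E_refl x w'(2) by blast
      qed
      ultimately show ?thesis
        using zero_unique zero_mono[OF z(2) x(1)] x(2) D_mono[OF x(1) z(1)] unfolding pts_dm_def le_dm_def by blast
    qed
    then have "le_dm w' a z" using c w'(1) z unfolding cov_dm_def pts_dm_def by blast
    then show False using zero_one zero_E_cong E_sym a1 z unfolding le_dm_def by blast
  qed
next
  assume c: "zero w a \<or> (\<forall>w'. w \<sqsubseteq> w' \<longrightarrow> (\<exists>w''. w' \<sqsubseteq> w'' \<and> M w'' a u))"
  show "cov_dm w a u"
    unfolding cov_dm_def
  proof (intro allI ballI impI)
    fix w' y assume w': "w \<sqsubseteq> w'" and y: "y \<in> D w'" "pts_dm w' y"
      and ub: "\<forall>w''. w' \<sqsubseteq> w'' \<longrightarrow> (\<forall>x\<in>D w''. M w'' x u \<longrightarrow> le_dm w'' x y)"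
    have aD: "a \<in> D w'" using D_mono[OF w' D(1)] .
    show "le_dm w' a y"
    proof (cases "zero w a")
      case True
      then have "zero w' a" using zero_mono w' by blast
      then show ?thesis using y zero_unique aD unfolding pts_dm_def le_dm_def by blast
    next
      case False
      then have a1: "one w' a" using a one_mono w' unfolding pts_dm_def by blast
      \<comment> \<open>A single later world suffices: \<open>y\<close> is already 0 or 1 at
        \<open>w'\<close>, and being 0 would persist to \<open>w''\<close>.\<close>
      obtain w'' where w'': "w' \<sqsubseteq> w''" "M w'' a u" using c False w' by blast
      then have "le_dm w'' a y" using ub M_D by blast
      then have "E w'' a y" using zero_one one_mono[OF a1 w''(1)] unfolding le_dm_def by blast
      then have "\<not> zero w' y"
        using zero_one one_mono[OF a1 w''(1)] one_E_cong zero_mono[OF _ w''(1)] by blast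
      then show ?thesis using y a1 one_unique aD unfolding pts_dm_def le_dm_def by blast
    qed
  qed
qed

text \<open>0 lies below every upper bound, so the empty set covers it and it makes up
  \<open>R\<close>; 1 makes up \<open>U\<close>.\<close>

lemma notnot_space_S_DM: "notnot_space (\<sqsubseteq>) D M E pts_dm cov_dm zero one S_DM"
proof unfold_locales
  show "\<exists>r\<in>D w. isset w r zero" for w using ex_one unfolding one_def .
  show "\<exists>s\<in>D w. isset w s pts_dm" for w
  proof -
    obtain z t where z: "z \<in> D w" "zero w z" and t: "t \<in> D w" "one w t" using ex_zero ex_one by meson
    obtain s where s: "s \<in> D w" "isset w s (duo z t)" using ex_duo z t by blast
    have "isset w s pts_dm"
    proof (rule isset_transfer[OF s(2)])
      fix w' x assume w': "w \<sqsubseteq> w'" "x \<in> D w'"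
      have "z \<in> D w'" "zero w' z" "t \<in> D w'" "one w' t"
        using z t w' D_mono zero_mono one_mono by blast+
      then show "duo z t w' x = pts_dm w' x"
        using w' zero_unique one_unique zero_E_cong one_E_cong E_sym unfolding duo_def pts_dm_def by meson
    qed
    then show ?thesis using s by blast
  qed
qed (auto simp: pts_dm_def cov_dm_iff intro: space_denotes_S_DM one_unique zero_mono one_mono
    zero_E_cong zero_one)

text \<open>In a covering formula the point has index 0 and the subset index 1. At depth 2 these are
  levels 1 and 0, whence the order of the arguments of \<open>cov S_DM\<close>.\<close>

lemma space_of_S_DM: "space_denotes \<rho> (space_of (pts S_DM 0 1) (cov S_DM 1 0 2)) pts_dm cov_dm"
  unfolding space_denotes_def space_of_def One_nat_def numeral_2_eq_2
  by (simp add: sat_sch1 sat_sch2 sem_sat1 sem_sat2 sat_pts[OF space_denotes_S_DM]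
      sat_cov[OF space_denotes_S_DM])

end

lemma definable_identity_pow_notnot: "definable 1 (identity_fm pow_notnot)"
  by (auto simp: definable_def identity_fm_def is_identity_def pow_notnot_def is_zero_def is_set_of_def
      is_pair_def sing_def upair_def form_defs)

lemma definable_S_DM:
  "definable 1 (identity_fm S_DM)" "definable 1 (pts S_DM 0 1)" "definable 2 (cov S_DM 1 0 2)"
  by (auto simp: definable_def identity_fm_def is_identity_def S_DM_def pts_DM_def le_DM_def
      is_zero_def is_one_def is_set_of_def is_pair_def sing_def upair_def form_defs)

theorem mainTheorem18:
  shows "(\<exists>p q. is_product pow_notnot pow_notnot pow_notnot p q) \<and>
    predicatively_definable_product S_DM S_DM"
proof
  have "is_product pow_notnot pow_notnot pow_notnot (identity_fm pow_notnot) (identity_fm pow_notnot)"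
    using czf_model.notnot_space_pow_notnot czf_model.space_denotes_pow_notnot
    by (intro identity_product definable_identity_pow_notnot) blast
  then show "\<exists>p q. is_product pow_notnot pow_notnot pow_notnot p q" by blast
  have "is_product (space_of (pts S_DM 0 1) (cov S_DM 1 0 2)) S_DM S_DM (identity_fm S_DM) (identity_fm S_DM)"
    using czf_model.notnot_space_S_DM czf_model.space_of_S_DM
    by (intro identity_product definable_S_DM) blast
  then show "predicatively_definable_product S_DM S_DM"
    unfolding predicatively_definable_product_def using definable_S_DM by blast
qed

end
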